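(* Let $M\subseteq\mathbb{Z}^m$ be a positive affine seminormal monoid, $K$ a field and $R=K[M]$. If $H^i_\mathfrak m(R)_a\neq 0$ for some $i$ and some $a\in\operatorname{gp}(M)$, then $a\in-\overline{M\cap F}$ for some face $F$ of $\operatorname{cn}(M)$ with $\dim F\le i$. In particular $H^i_\mathfrak m(R)_a=0$ for all $i$ and all $a\in\operatorname{gp}(M)$ with $a\notin-\operatorname{cn}(M)$.
   Context: An affine monoid is a finitely generated submonoid $M\subseteq\mathbb{Z}^m$; it is positive if $0$ is its only invertible element. $\operatorname{gp}(M)$ is the group generated by $M$; $\operatorname{cn}(M)\subseteq\mathbb{R}^m$ is the cone of nonnegative real combinations of $M$; faces of $\operatorname{cn}(M)$ include $\operatorname{cn}(M)$ itself. For a face $F$, $\overline{M\cap F}=\operatorname{gp}(M\cap F)\cap F$, and $-W=\{-w:w\in W\}$. $M$ is seminormal if $z\in\operatorname{gp}(M)$, $2z\in M$, $3z\in M$ imply $z\in M$. $R=K[M]$ is the monoid algebra, $\mathbb{Z}^m$-graded with $\deg X^a=a$; $\mathfrak m$ is the maximal ideal generated by all $X^a$, $a\in M\setminus\{0\}$, and $H^i_\mathfrak m(R)$ is the $\mathbb{Z}^m$-graded local cohomology with graded components $H^i_\mathfrak m(R)_a$. *)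

theory Defs
  imports "HOL-Analysis.Analysis"
begin

definition rvec :: "int^'n \<Rightarrow> real^'n" where
  "rvec x = (\<chi> i. of_int (x $ i))"

definition monoid_gen :: "(int^'n) set \<Rightarrow> (int^'n) set" where
  "monoid_gen G = {x. \<exists>S c. finite S \<and> S \<subseteq> G \<and> x = (\<Sum>g\<in>S. of_nat (c g :: nat) *s g)}"

definition affine_monoid :: "(int^'n) set \<Rightarrow> bool" where
  "affine_monoid M \<longleftrightarrow> (\<exists>G. finite G \<and> M = monoid_gen G)"

definition positive_monoid :: "(int^'n) set \<Rightarrow> bool" where
  "positive_monoid M \<longleftrightarrow> (\<forall>x\<in>M. - x \<in> M \<longrightarrow> x = 0)"

definition gp :: "(int^'n) set \<Rightarrow> (int^'n) set" where
  "gp M = {x - y | x y. x \<in> M \<and> y \<in> M}"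

definition seminormal :: "(int^'n) set \<Rightarrow> bool" where
  "seminormal M \<longleftrightarrow> (\<forall>z \<in> gp M. 2 *s z \<in> M \<and> 3 *s z \<in> M \<longrightarrow> z \<in> M)"

definition cn :: "(int^'n) set \<Rightarrow> (real^'n) set" where
  "cn M = {x. \<exists>S c. finite S \<and> S \<subseteq> M \<and> (\<forall>s\<in>S. c s \<ge> (0::real)) \<and>
                  x = (\<Sum>s\<in>S. c s *\<^sub>R rvec s)}"

definition Mbar :: "(int^'n) set \<Rightarrow> (real^'n) set \<Rightarrow> (int^'n) set" where
  "Mbar M F = {x \<in> gp {y \<in> M. rvec y \<in> F}. rvec x \<in> F}"

text \<open>Z^m-graded local cohomology of K[M] via the Cech complex on the monomials
  X^g, g in gs (a list of generators of M; the ideal they generate is m).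
  Localisation of K[M] at X^g (g in index set S) is K[M_S], with
  M_S = M + sum of Z*g, g in S.  Its degree-a component is K if a \<in> M_S and 0 otherwise.\<close>
definition Mloc :: "(int^'n) set \<Rightarrow> (int^'n) list \<Rightarrow> nat set \<Rightarrow> (int^'n) set" where
  "Mloc M gs S = {x + (\<Sum>j\<in>S. of_int (k j) *s (gs ! j)) | x k. x \<in> M}"

text \<open>Degree-a part of the i-th Cech cochain module: functions on the i-subsets S of
  indices with a \<in> M_S (coordinates of the direct sum of copies of K).\<close>
definition cech_cochain ::
  "'k::field itself \<Rightarrow> (int^'n) set \<Rightarrow> (int^'n) list \<Rightarrow> nat \<Rightarrow> int^'n \<Rightarrow> (nat set \<Rightarrow> 'k) \<Rightarrow> bool" where
  "cech_cochain K M gs i a f \<longleftrightarrow>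
     (\<forall>S. f S \<noteq> 0 \<longrightarrow> S \<subseteq> {..<length gs} \<and> card S = i \<and> a \<in> Mloc M gs S)"

definition cech_diff :: "(nat set \<Rightarrow> 'k::field) \<Rightarrow> nat set \<Rightarrow> 'k" where
  "cech_diff f T = (\<Sum>t\<in>T. (-1) ^ card {s \<in> T. s < t} * f (T - {t}))"

definition loc_coh_nonzero ::
  "'k::field itself \<Rightarrow> (int^'n) set \<Rightarrow> (int^'n) list \<Rightarrow> nat \<Rightarrow> int^'n \<Rightarrow> bool" where
  "loc_coh_nonzero K M gs i a \<longleftrightarrow>
     (\<exists>f. cech_cochain K M gs i a f \<and>
          (\<forall>T. T \<subseteq> {..<length gs} \<and> card T = Suc i \<and> a \<in> Mloc M gs T \<longrightarrow> cech_diff f T = 0) \<and>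
          (if i = 0 then f \<noteq> (\<lambda>_. 0)
           else \<not> (\<exists>g. cech_cochain K M gs (i - 1) a g \<and>
                    (\<forall>S. S \<subseteq> {..<length gs} \<and> card S = i \<and> a \<in> Mloc M gs S \<longrightarrow> f S = cech_diff g S))))"

end

theory Submission
  imports Defs
begin

text \<open>Fix a degree \<open>a\<close>. The Cech complex in degree \<open>a\<close> lives on the up-closed family of index sets
  \<open>S\<close> with \<open>a \<in> M\<^sub>S\<close>, and this family is filtered by a monotone map from index sets to faces,
  so it suffices to treat the fibres.

  If \<open>a\<close> is not in \<open>-cn(M)\<close>, map \<open>S\<close> to the smallest face \<open>G\<close> with \<open>a \<in> G + span S\<close>. Seminormality
  makes membership \<open>a \<in> M\<^sub>S\<close> constant on fibres. By complementation, a fibre is the nerve of the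
  half-spaces \<open>c\<^sub>v > 0\<close> in the affine space of all \<open>c\<close> with \<open>\<Sum> c\<^sub>v v = a\<close>, where \<open>v\<close> runs through the
  generators in \<open>G\<close>. These half-spaces cover the affine space because \<open>a\<close> is not in \<open>-cn(M)\<close>, so the
  nerve is acyclic and the cohomology vanishes.

  If \<open>a \<in> -cn(M)\<close>, map \<open>S\<close> to the smallest face \<open>G\<close> containing \<open>S\<close>. Now a fibre is the nerve of the
  half-spaces \<open>c\<^sub>v > 0\<close> in the linear space of relations between the generators in \<open>G\<close>. For dimension
  reasons its cohomology vanishes below degree \<open>dim G\<close>. So nonzero cohomology in degree \<open>i\<close> gives a set
  \<open>S\<close> with \<open>a \<in> M\<^sub>S\<close> that generates a face \<open>G\<close> of dimension at most \<open>i\<close>, and then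
  \<open>a \<in> -cn(M)\<close> forces \<open>a\<close> into \<open>-G\<close> and into the group generated by \<open>M \<inter> G\<close>.\<close>

subsection \<open>Exactness of Cech cochains on families of index sets\<close>

text \<open>Cochains supported on a family \<open>\<F>\<close> form a complex only if \<open>\<F>\<close> is order convex; it is then
  a subquotient of the full simplex.\<close>

definition exact_at :: "'k::field itself \<Rightarrow> nat \<Rightarrow> nat set set \<Rightarrow> bool" where
  "exact_at K i \<F> \<longleftrightarrow>
     (\<forall>f :: nat set \<Rightarrow> 'k.
        (\<forall>S. f S \<noteq> 0 \<longrightarrow> S \<in> \<F> \<and> card S = i) \<longrightarrow>
        (\<forall>T\<in>\<F>. card T = Suc i \<longrightarrow> cech_diff f T = 0) \<longrightarrow>
        (\<exists>g. (\<forall>S. g S \<noteq> 0 \<longrightarrow> S \<in> \<F> \<and> Suc (card S) = i) \<and>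
             (\<forall>S\<in>\<F>. card S = i \<longrightarrow> cech_diff g S = f S)))"

lemma exact_atI:
  assumes "\<And>f :: nat set \<Rightarrow> 'k.
    (\<And>S. f S \<noteq> 0 \<Longrightarrow> S \<in> \<F> \<and> card S = i) \<Longrightarrow>
    (\<And>T. T \<in> \<F> \<Longrightarrow> card T = Suc i \<Longrightarrow> cech_diff f T = 0) \<Longrightarrow>
    \<exists>g. (\<forall>S. g S \<noteq> 0 \<longrightarrow> S \<in> \<F> \<and> Suc (card S) = i) \<and>
        (\<forall>S\<in>\<F>. card S = i \<longrightarrow> cech_diff g S = f S)"
  shows "exact_at (K :: 'k::field itself) i \<F>"
  unfolding exact_at_def by (intro allI impI, rule assms) simp_all

lemma exact_atD:
  fixes f :: "nat set \<Rightarrow> 'k::field"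
  assumes "exact_at (K :: 'k itself) i \<F>"
    and "\<And>S. f S \<noteq> 0 \<Longrightarrow> S \<in> \<F> \<and> card S = i"
    and "\<And>T. T \<in> \<F> \<Longrightarrow> card T = Suc i \<Longrightarrow> cech_diff f T = 0"
  shows "\<exists>g. (\<forall>S. g S \<noteq> 0 \<longrightarrow> S \<in> \<F> \<and> Suc (card S) = i) \<and>
        (\<forall>S\<in>\<F>. card S = i \<longrightarrow> cech_diff g S = f S)"
  by (rule assms(1)[unfolded exact_at_def, rule_format]) (use assms in simp_all)

definition order_convex :: "'a set set \<Rightarrow> bool" where
  "order_convex \<F> \<longleftrightarrow> (\<forall>R\<in>\<F>. \<forall>T\<in>\<F>. \<forall>S. R \<subseteq> S \<longrightarrow> S \<subseteq> T \<longrightarrow> S \<in> \<F>)"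

lemma order_convexD:
  "order_convex \<F> \<Longrightarrow> R \<in> \<F> \<Longrightarrow> T \<in> \<F> \<Longrightarrow> R \<subseteq> S \<Longrightarrow> S \<subseteq> T \<Longrightarrow> S \<in> \<F>"
  unfolding order_convex_def by blast

lemma cech_diff_add: "cech_diff (\<lambda>S. f S + g S) T = cech_diff f T + cech_diff g T"
  by (simp add: cech_diff_def algebra_simps sum.distrib)

lemma cech_diff_minus: "cech_diff (\<lambda>S. f S - g S) T = cech_diff f T - cech_diff g T"
  by (simp add: cech_diff_def algebra_simps sum_subtractf)

lemma cech_diff_cong:
  "(\<And>t. t \<in> T \<Longrightarrow> f (T - {t}) = g (T - {t})) \<Longrightarrow> cech_diff f T = cech_diff g T"
  by (simp add: cech_diff_def)

lemma cech_diff_eq_0: "(\<And>t. t \<in> T \<Longrightarrow> f (T - {t}) = 0) \<Longrightarrow> cech_diff f T = 0"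
  by (simp add: cech_diff_def)

lemma cech_diff_nonzeroE:
  assumes "cech_diff f T \<noteq> 0"
  obtains t where "t \<in> T" "f (T - {t}) \<noteq> 0"
  using assms cech_diff_eq_0 by blast

lemma finite_if_cech_diff_nonzero: "cech_diff f T \<noteq> 0 \<Longrightarrow> finite T"
  by (rule ccontr) (simp add: cech_diff_def)

text \<open>Removing the larger element \<open>t\<close> does not change the position of
  \<open>s\<close>, whereas removing \<open>s\<close> lowers the position of \<open>t\<close> by
  one. This is the sign behind the vanishing of the squared differential.\<close>

lemma cech_sign_swap:
  assumes "finite T" "t \<in> T" "s \<in> T" "s < (t::nat)"
  shows "(-1) ^ card {r \<in> T. r < t} * (-1) ^ card {r \<in> T - {t}. r < s} =
    - ((-1) ^ card {r \<in> T. r < s} * (-1) ^ card {r \<in> T - {s}. r < t} :: 'k::field)"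
proof -
  have 1: "{r \<in> T - {t}. r < s} = {r \<in> T. r < s}" using assms by auto
  have "{r \<in> T. r < t} = insert s {r \<in> T - {s}. r < t}" using assms by auto
  then have 2: "card {r \<in> T. r < t} = Suc (card {r \<in> T - {s}. r < t})"
    using assms by simp
  show ?thesis unfolding 1 2 by simp
qed

text \<open>The double sum runs over ordered pairs of distinct elements of \<open>T\<close>; the
  summands \<open>h t s\<close> and \<open>h s t\<close> drop the same two elements and
  cancel.\<close>

lemma cech_diff_cech_diff:
  fixes g :: "nat set \<Rightarrow> 'k::field"
  assumes "finite T"
  shows "cech_diff (cech_diff g) T = 0"
proof -
  define h where "h t s = (-1) ^ card {r \<in> T. r < t} * (-1) ^ card {r \<in> T - {t}. r < s} * g (T - {t} - {s})" for t s
  have anti: "h t s = - h s t" if "s \<in> T" "t \<in> T" "s < t" for s t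
  proof -
    have "T - {t} - {s} = T - {s} - {t}" by auto
    then show ?thesis
      unfolding h_def using cech_sign_swap[OF assms that(2,1,3), where 'k='k] by simp
  qed
  have split: "sum (h t) (T - {t}) = sum (h t) {s \<in> T. s < t} + sum (h t) {s \<in> T. t < s}" for t
  proof -
    have "T - {t} = {s \<in> T. s < t} \<union> {s \<in> T. t < s}" by auto
    moreover have "{s \<in> T. s < t} \<inter> {s \<in> T. t < s} = {}" by auto
    ultimately show ?thesis using assms by (simp add: sum.union_disjoint)
  qed
  have "cech_diff (cech_diff g) T = (\<Sum>t\<in>T. sum (h t) (T - {t}))"
    by (simp add: cech_diff_def h_def sum_distrib_left mult.assoc)
  also have "\<dots> = (\<Sum>t\<in>T. \<Sum>s\<in>{s\<in>T. s < t}. h t s) + (\<Sum>t\<in>T. \<Sum>s\<in>{s\<in>T. t < s}. h t s)"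
    by (simp add: split sum.distrib)
  also have "(\<Sum>t\<in>T. \<Sum>s\<in>{s\<in>T. t < s}. h t s) = (\<Sum>s\<in>T. \<Sum>t\<in>{t\<in>T. t < s}. h t s)"
    using assms by (rule sum.swap_restrict) (use assms in auto)
  also have "\<dots> = - (\<Sum>t\<in>T. \<Sum>s\<in>{s\<in>T. s < t}. h t s)"
    by (simp add: sum_negf[symmetric]) (intro sum.cong refl, use anti in auto)
  finally show ?thesis by simp
qed

text \<open>Truncating to an order convex family still gives a complex: a set \<open>T - {t}\<close>
  lies between a member \<open>T - {t} - {s}\<close> supporting \<open>g\<close> and the member
  \<open>T\<close>, so truncation discards only zero values.\<close>

lemma cech_diff_restrict_cech_diff:
  fixes g :: "nat set \<Rightarrow> 'k::field"
  assumes "order_convex \<F>" "\<And>S. g S \<noteq> 0 \<Longrightarrow> S \<in> \<F>" "T \<in> \<F>" "finite T"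
  shows "cech_diff (\<lambda>S. if S \<in> \<F> then cech_diff g S else 0) T = 0"
proof -
  have "cech_diff (\<lambda>S. if S \<in> \<F> then cech_diff g S else 0) T = cech_diff (cech_diff g) T"
  proof (rule cech_diff_cong)
    fix t assume "t \<in> T"
    have "cech_diff g (T - {t}) = 0" if "T - {t} \<notin> \<F>"
    proof (rule ccontr)
      assume "cech_diff g (T - {t}) \<noteq> 0"
      then obtain s where "g (T - {t} - {s}) \<noteq> 0" by (rule cech_diff_nonzeroE)
      then have "T - {t} - {s} \<in> \<F>" by (rule assms(2))
      then have "T - {t} \<in> \<F>" by (rule order_convexD[OF assms(1) _ assms(3)]) auto
      with that show False ..
    qed
    then show "(if T - {t} \<in> \<F> then cech_diff g (T - {t}) else 0) = cech_diff g (T - {t})" by simp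
  qed
  then show ?thesis by (simp add: cech_diff_cech_diff assms)
qed

section \<open>Subcomplexes, quotients and contractible families\<close>

text \<open>Since no member of \<open>\<B>\<close> lies below one of \<open>\<A>\<close>, cochains
  on \<open>\<B>\<close> form a subcomplex with quotient the cochains on \<open>\<A>\<close>. This
  is the middle term of the long exact sequence, chased by hand.\<close>

lemma exact_at_extension:
  fixes K :: "'k::field itself"
  assumes conv: "order_convex (\<A> \<union> \<B>)"
    and up: "\<And>S T. S \<in> \<B> \<Longrightarrow> T \<in> \<A> \<Longrightarrow> \<not> S \<subseteq> T"
    and fin: "\<And>S. S \<in> \<A> \<union> \<B> \<Longrightarrow> finite S"
    and exA: "exact_at K i \<A>" and exB: "exact_at K i \<B>"
  shows "exact_at K i (\<A> \<union> \<B>)"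
proof (rule exact_atI)
  fix f :: "nat set \<Rightarrow> 'k"
  assume supp: "\<And>S. f S \<noteq> 0 \<Longrightarrow> S \<in> \<A> \<union> \<B> \<and> card S = i"
    and cyc: "\<And>T. T \<in> \<A> \<union> \<B> \<Longrightarrow> card T = Suc i \<Longrightarrow> cech_diff f T = 0"
  define f1 where "f1 S = (if S \<in> \<A> then f S else 0)" for S
  have "cech_diff f1 T = 0" if "T \<in> \<A>" "card T = Suc i" for T
  proof -
    have "cech_diff f1 T = cech_diff f T"
    proof (rule cech_diff_cong)
      fix t assume "t \<in> T"
      have "f (T - {t}) = 0" if "T - {t} \<notin> \<A>"
        using supp that up[OF _ \<open>T \<in> \<A>\<close>] by blast
      then show "f1 (T - {t}) = f (T - {t})" by (auto simp: f1_def)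
    qed
    then show ?thesis using cyc that by simp
  qed
  moreover have "S \<in> \<A> \<and> card S = i" if "f1 S \<noteq> 0" for S
    using supp that by (auto simp: f1_def split: if_splits)
  ultimately have "\<exists>g. (\<forall>S. g S \<noteq> 0 \<longrightarrow> S \<in> \<A> \<and> Suc (card S) = i) \<and>
      (\<forall>S\<in>\<A>. card S = i \<longrightarrow> cech_diff g S = f1 S)"
    by (intro exact_atD[OF exA])
  then obtain g1 where g1: "\<And>S. g1 S \<noteq> 0 \<Longrightarrow> S \<in> \<A> \<and> Suc (card S) = i"
    and dg1: "\<And>S. S \<in> \<A> \<Longrightarrow> card S = i \<Longrightarrow> cech_diff g1 S = f1 S"
    by blast
  have dg1_card: "card S = i" if "cech_diff g1 S \<noteq> 0" for S
  proof -
    obtain t where "t \<in> S" "g1 (S - {t}) \<noteq> 0" using \<open>cech_diff g1 S \<noteq> 0\<close> by (rule cech_diff_nonzeroE)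
    then show ?thesis using g1 finite_if_cech_diff_nonzero[OF that] by (metis card_Suc_Diff1)
  qed
  \<comment> \<open>A primitive of \<open>f\<close> on the quotient is available; subtracting its
    differential leaves a cocycle supported on the subcomplex \<open>\<B>\<close>.\<close>
  define f2 where "f2 S = f S - (if S \<in> \<A> \<union> \<B> then cech_diff g1 S else 0)" for S
  have "S \<in> \<B> \<and> card S = i" if *: "f2 S \<noteq> 0" for S
  proof -
    from * have "f S \<noteq> 0 \<or> S \<in> \<A> \<union> \<B> \<and> cech_diff g1 S \<noteq> 0"
      by (auto simp: f2_def split: if_splits)
    then have 1: "S \<in> \<A> \<union> \<B>" "card S = i" using supp[of S] dg1_card[of S] by auto
    moreover have "S \<notin> \<A>"
      using * 1 dg1[of S] by (auto simp: f2_def f1_def)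
    ultimately show "S \<in> \<B> \<and> card S = i" by auto
  qed
  moreover have "cech_diff f2 T = 0" if "T \<in> \<B>" "card T = Suc i" for T
  proof -
    have "cech_diff (\<lambda>S. if S \<in> \<A> \<union> \<B> then cech_diff g1 S else 0) T = 0"
      by (rule cech_diff_restrict_cech_diff[OF conv]) (use g1 fin[of T] that in auto)
    then show ?thesis
      unfolding f2_def cech_diff_minus using cyc[of T] that by simp
  qed
  ultimately have "\<exists>g. (\<forall>S. g S \<noteq> 0 \<longrightarrow> S \<in> \<B> \<and> Suc (card S) = i) \<and>
      (\<forall>S\<in>\<B>. card S = i \<longrightarrow> cech_diff g S = f2 S)"
    by (intro exact_atD[OF exB])
  then obtain g2 where g2: "\<And>S. g2 S \<noteq> 0 \<Longrightarrow> S \<in> \<B> \<and> Suc (card S) = i"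
    and dg2: "\<And>S. S \<in> \<B> \<Longrightarrow> card S = i \<Longrightarrow> cech_diff g2 S = f2 S"
    by blast
  show "\<exists>g. (\<forall>S. g S \<noteq> 0 \<longrightarrow> S \<in> \<A> \<union> \<B> \<and> Suc (card S) = i) \<and>
             (\<forall>S\<in>\<A> \<union> \<B>. card S = i \<longrightarrow> cech_diff g S = f S)"
  proof (intro exI[of _ "\<lambda>S. g1 S + g2 S"] conjI allI ballI impI)
    fix S assume "g1 S + g2 S \<noteq> 0"
    then have "g1 S \<noteq> 0 \<or> g2 S \<noteq> 0" by auto
    then show "S \<in> \<A> \<union> \<B>" "Suc (card S) = i" using g1[of S] g2[of S] by auto
  next
    fix S assume S: "S \<in> \<A> \<union> \<B>" "card S = i"
    show "cech_diff (\<lambda>S. g1 S + g2 S) S = f S"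
    proof (cases "S \<in> \<A>")
      case True
      have "cech_diff g2 S = 0"
        by (rule cech_diff_eq_0) (use g2 up[OF _ True] in blast)
      then show ?thesis using dg1[OF True S(2)] True by (simp add: cech_diff_add f1_def)
    next
      case False
      then show ?thesis using S dg2[of S] by (simp add: cech_diff_add f2_def)
    qed
  qed
qed

text \<open>The segment of the same long exact sequence in which the cohomology on
  \<open>\<A>\<close> in degree \<open>i\<close> sits between that of the union in degree
  \<open>i\<close> and that of \<open>\<B>\<close> in degree \<open>i + 1\<close>.\<close>

lemma exact_at_lower_part:
  fixes K :: "'k::field itself"
  assumes conv: "order_convex (\<A> \<union> \<B>)"
    and up: "\<And>S T. S \<in> \<B> \<Longrightarrow> T \<in> \<A> \<Longrightarrow> \<not> S \<subseteq> T"
    and fin: "\<And>S. S \<in> \<A> \<union> \<B> \<Longrightarrow> finite S"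
    and exAB: "exact_at K i (\<A> \<union> \<B>)" and exB: "exact_at K (Suc i) \<B>"
  shows "exact_at K i \<A>"
proof (rule exact_atI)
  fix f :: "nat set \<Rightarrow> 'k"
  assume supp: "\<And>S. f S \<noteq> 0 \<Longrightarrow> S \<in> \<A> \<and> card S = i"
    and cyc: "\<And>T. T \<in> \<A> \<Longrightarrow> card T = Suc i \<Longrightarrow> cech_diff f T = 0"
  have disj: "S \<notin> \<A>" if "S \<in> \<B>" for S using up[OF that] by blast
  have df_card: "card S = Suc i" if "cech_diff f S \<noteq> 0" for S
  proof -
    obtain t where "t \<in> S" "f (S - {t}) \<noteq> 0" using \<open>cech_diff f S \<noteq> 0\<close> by (rule cech_diff_nonzeroE)
    then show ?thesis using supp finite_if_cech_diff_nonzero[OF that] by (metis card_Suc_Diff1)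
  qed
  \<comment> \<open>\<open>e\<close> represents the image of \<open>f\<close> under the connecting
    map: as \<open>f\<close> is a cocycle on \<open>\<A>\<close>, its differential in the union
    lives on \<open>\<B>\<close>.\<close>
  define e where "e S = (if S \<in> \<A> \<union> \<B> then cech_diff f S else 0)" for S
  have "S \<in> \<B> \<and> card S = Suc i" if "e S \<noteq> 0" for S
  proof -
    have "cech_diff f S \<noteq> 0" "S \<in> \<A> \<union> \<B>"
      using that by (auto simp: e_def split: if_splits)
    then show ?thesis using cyc[of S] df_card[of S] by blast
  qed
  moreover have "cech_diff e T = 0" if "T \<in> \<B>" for T
    unfolding e_def
    by (rule cech_diff_restrict_cech_diff[OF conv]) (use supp fin[of T] that in auto)
  ultimately have "\<exists>g. (\<forall>S. g S \<noteq> 0 \<longrightarrow> S \<in> \<B> \<and> Suc (card S) = Suc i) \<and>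
      (\<forall>S\<in>\<B>. card S = Suc i \<longrightarrow> cech_diff g S = e S)"
    by (intro exact_atD[OF exB])
  then obtain g where g': "\<And>S. g S \<noteq> 0 \<Longrightarrow> S \<in> \<B> \<and> Suc (card S) = Suc i"
    and dg: "\<And>S. S \<in> \<B> \<Longrightarrow> card S = Suc i \<Longrightarrow> cech_diff g S = e S"
    by blast
  have g: "S \<in> \<B> \<and> card S = i" if "g S \<noteq> 0" for S using g'[OF that] by simp
  \<comment> \<open>Correcting \<open>f\<close> by the primitive \<open>g\<close> of
    \<open>e\<close> makes it a cocycle on the whole union without changing it on
    \<open>\<A>\<close>.\<close>
  define k where "k S = f S - g S" for S
  have dk: "cech_diff k T = cech_diff f T - cech_diff g T" for T
    unfolding k_def by (rule cech_diff_minus)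
  have "S \<in> \<A> \<union> \<B> \<and> card S = i" if "k S \<noteq> 0" for S
  proof -
    have "f S \<noteq> 0 \<or> g S \<noteq> 0" using that by (auto simp: k_def)
    then show ?thesis using supp[of S] g[of S] by auto
  qed
  moreover have "cech_diff k T = 0" if T: "T \<in> \<A> \<union> \<B>" "card T = Suc i" for T
  proof (cases "T \<in> \<A>")
    case True
    have "cech_diff g T = 0"
      by (rule cech_diff_eq_0) (use g up[OF _ True] in blast)
    then show ?thesis using cyc True T by (simp add: dk)
  next
    case False
    then show ?thesis using T dg[of T] by (simp add: dk e_def)
  qed
  ultimately have "\<exists>g. (\<forall>S. g S \<noteq> 0 \<longrightarrow> S \<in> \<A> \<union> \<B> \<and> Suc (card S) = i) \<and>
      (\<forall>S\<in>\<A> \<union> \<B>. card S = i \<longrightarrow> cech_diff g S = k S)"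
    by (intro exact_atD[OF exAB])
  then obtain h where h: "\<And>S. h S \<noteq> 0 \<Longrightarrow> S \<in> \<A> \<union> \<B> \<and> Suc (card S) = i"
    and dh: "\<And>S. S \<in> \<A> \<union> \<B> \<Longrightarrow> card S = i \<Longrightarrow> cech_diff h S = f S - g S"
    unfolding k_def by blast
  show "\<exists>g. (\<forall>S. g S \<noteq> 0 \<longrightarrow> S \<in> \<A> \<and> Suc (card S) = i) \<and>
             (\<forall>S\<in>\<A>. card S = i \<longrightarrow> cech_diff g S = f S)"
  proof (intro exI[of _ "\<lambda>S. if S \<in> \<A> then h S else 0"] conjI allI ballI impI)
    fix S assume "(if S \<in> \<A> then h S else 0) \<noteq> 0"
    then show "S \<in> \<A>" "Suc (card S) = i" using h[of S] by (auto split: if_splits)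
  next
    fix S assume S: "S \<in> \<A>" "card S = i"
    \<comment> \<open>Sets below a member of \<open>\<A>\<close> are never in \<open>\<B>\<close>,
      so cutting \<open>h\<close> down to \<open>\<A>\<close> is invisible here.\<close>
    have "cech_diff (\<lambda>S. if S \<in> \<A> then h S else 0) S = cech_diff h S"
    proof (rule cech_diff_cong)
      fix t
      have "S - {t} \<notin> \<B>" using up[OF _ S(1)] by blast
      then show "(if S - {t} \<in> \<A> then h (S - {t}) else 0) = h (S - {t})" using h[of "S - {t}"] by auto
    qed
    also have "\<dots> = f S" using dh[of S] S g[of S] disj[of S] by auto
    finally show "cech_diff (\<lambda>S. if S \<in> \<A> then h S else 0) S = f S" .
  qed
qed

text \<open>Membership in \<open>\<F>\<close> does not depend on \<open>w\<close>, so inserting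
  \<open>w\<close>, with the appropriate sign, is a contracting homotopy.\<close>

lemma exact_at_cone:
  fixes K :: "'k::field itself"
  assumes cone: "\<And>S. insert w S \<in> \<F> \<longleftrightarrow> S - {w} \<in> \<F>"
    and fin: "\<And>S. S \<in> \<F> \<Longrightarrow> finite S"
  shows "exact_at K i \<F>"
proof (rule exact_atI)
  fix f :: "nat set \<Rightarrow> 'k"
  assume supp: "\<And>S. f S \<noteq> 0 \<Longrightarrow> S \<in> \<F> \<and> card S = i"
    and cyc: "\<And>T. T \<in> \<F> \<Longrightarrow> card T = Suc i \<Longrightarrow> cech_diff f T = 0"
  define \<epsilon> :: "nat set \<Rightarrow> nat \<Rightarrow> 'k" where "\<epsilon> S t = (-1) ^ card {s \<in> S. s < t}" for S t
  have \<epsilon>\<epsilon>: "\<epsilon> S t * \<epsilon> S t = 1" for S t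
    unfolding \<epsilon>_def by (simp add: minus_one_power_iff)
  have d: "cech_diff f T = (\<Sum>t\<in>T. \<epsilon> T t * f (T - {t}))" for f T
    by (simp add: cech_diff_def \<epsilon>_def)
  define g where "g S = (if w \<in> S then 0 else \<epsilon> S w * f (insert w S))" for S
  show "\<exists>g. (\<forall>S. g S \<noteq> 0 \<longrightarrow> S \<in> \<F> \<and> Suc (card S) = i) \<and>
             (\<forall>S\<in>\<F>. card S = i \<longrightarrow> cech_diff g S = f S)"
  proof (intro exI[of _ g] conjI allI ballI impI)
    fix S assume gS: "g S \<noteq> 0"
    then have w: "w \<notin> S" and "f (insert w S) \<noteq> 0" by (auto simp: g_def split: if_splits)
    then have *: "insert w S \<in> \<F>" "card (insert w S) = i" using supp by auto
    then show "S \<in> \<F>" using cone[of S] w by simp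
    then show "Suc (card S) = i" using fin[of S] w * by simp
  next
    fix S assume S: "S \<in> \<F>" "card S = i"
    note finS = fin[OF S(1)]
    show "cech_diff g S = f S"
    proof (cases "w \<in> S")
      case True
      have "cech_diff g S = (\<Sum>t\<in>{w}. \<epsilon> S t * g (S - {t}))"
        unfolding d by (rule sum.mono_neutral_right) (use finS True in \<open>auto simp: g_def\<close>)
      also have "\<dots> = \<epsilon> S w * (\<epsilon> (S - {w}) w * f S)"
        by (simp add: g_def True insert_absorb)
      also have "\<epsilon> (S - {w}) w = \<epsilon> S w"
        unfolding \<epsilon>_def by (rule arg_cong[where f="\<lambda>A. (-1) ^ card A"]) auto
      finally show ?thesis using \<epsilon>\<epsilon>[of S w] by (simp add: mult.assoc[symmetric])
    next
      case False
      \<comment> \<open>The cocycle condition at \<open>?T\<close> expresses \<open>f S\<close>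
        through the values of \<open>f\<close> on the sets \<open>?T - {t}\<close>, which are
        exactly the values entering \<open>g (S - {t})\<close>.\<close>
      let ?T = "insert w S"
      have "?T \<in> \<F>" using cone[of S] False S by simp
      moreover have "card ?T = Suc i" using finS False S by simp
      ultimately have "0 = cech_diff f ?T" using cyc by simp
      also have "\<dots> = \<epsilon> ?T w * f S + (\<Sum>t\<in>S. \<epsilon> ?T t * f (?T - {t}))"
        unfolding d using finS False by simp
      finally have 0: "(\<Sum>t\<in>S. \<epsilon> ?T t * f (?T - {t})) = - \<epsilon> ?T w * f S"
        by (simp add: add_eq_0_iff)
      have Tw: "\<epsilon> ?T w = \<epsilon> S w"
        unfolding \<epsilon>_def by (rule arg_cong[where f="\<lambda>A. (-1) ^ card A"]) auto
      have "\<epsilon> S t * g (S - {t}) = - \<epsilon> S w * (\<epsilon> ?T t * f (?T - {t}))" if "t \<in> S" for t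
      proof -
        have "t \<noteq> w" using that False by auto
        have "\<epsilon> S t * \<epsilon> (S - {t}) w = - \<epsilon> ?T w * \<epsilon> ?T t"
        proof (cases "t < w")
          case True
          have 1: "?T - {w} = S" using False by auto
          have 2: "\<epsilon> (?T - {t}) w = \<epsilon> (S - {t}) w"
            unfolding \<epsilon>_def by (rule arg_cong[where f="\<lambda>A. (-1) ^ card A"]) auto
          have 3: "\<epsilon> ?T t = \<epsilon> S t"
            unfolding \<epsilon>_def by (rule arg_cong[where f="\<lambda>A. (-1) ^ card A"]) (use True in auto)
          have "\<epsilon> ?T w * \<epsilon> (?T - {w}) t = - (\<epsilon> ?T t * \<epsilon> (?T - {t}) w)"
            unfolding \<epsilon>_def by (rule cech_sign_swap) (use finS that True in auto)
          then show ?thesis unfolding 1 2 3 by simp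
        next
          case False
          then have "w < t" using \<open>t \<noteq> w\<close> by simp
          have "\<epsilon> (S - {t}) w = \<epsilon> S w"
            unfolding \<epsilon>_def by (rule arg_cong[where f="\<lambda>A. (-1) ^ card A"]) (use \<open>w < t\<close> in auto)
          moreover have "{s \<in> ?T. s < t} = insert w {s \<in> S. s < t}" using \<open>w < t\<close> by auto
          then have "\<epsilon> ?T t = - \<epsilon> S t"
            unfolding \<epsilon>_def using finS \<open>w \<notin> S\<close> by simp
          ultimately show ?thesis using Tw by simp
        qed
        moreover have "insert w (S - {t}) = ?T - {t}" using \<open>t \<noteq> w\<close> by auto
        moreover have "w \<notin> S - {t}" using False by simp
        ultimately show ?thesis using Tw False by (simp add: g_def mult.assoc[symmetric])
      qed
      then have "cech_diff g S = (\<Sum>t\<in>S. - \<epsilon> S w * (\<epsilon> ?T t * f (?T - {t})))"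
        unfolding d by (intro sum.cong refl)
      also have "\<dots> = - \<epsilon> S w * (\<Sum>t\<in>S. \<epsilon> ?T t * f (?T - {t}))"
        by (rule sum_distrib_left[symmetric])
      also have "\<dots> = \<epsilon> S w * \<epsilon> S w * f S" unfolding 0 Tw by simp
      finally show ?thesis using \<epsilon>\<epsilon> by simp
    qed
  qed
qed

lemma exact_at_if_no_card: "(\<And>S. S \<in> \<F> \<Longrightarrow> card S \<noteq> i) \<Longrightarrow> exact_at (K :: 'k::field itself) i \<F>"
proof (rule exact_atI)
  fix f :: "nat set \<Rightarrow> 'k"
  assume "\<And>S. S \<in> \<F> \<Longrightarrow> card S \<noteq> i" "\<And>S. f S \<noteq> 0 \<Longrightarrow> S \<in> \<F> \<and> card S = i"
  then show "\<exists>g. (\<forall>S. g S \<noteq> 0 \<longrightarrow> S \<in> \<F> \<and> Suc (card S) = i) \<and>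
      (\<forall>S\<in>\<F>. card S = i \<longrightarrow> cech_diff g S = f S)"
    by (intro exI[of _ "\<lambda>_. 0"]) blast
qed

text \<open>Induction on the number of values of \<open>\<phi>\<close>. By monotonicity the fibre
  over a maximal value is up-closed in \<open>\<F>\<close>, so it splits off as a
  subcomplex.\<close>

lemma exact_at_fibres:
  fixes \<phi> :: "nat set \<Rightarrow> 'a set"
  assumes "finite \<F>" "order_convex \<F>" "\<And>S. S \<in> \<F> \<Longrightarrow> finite S"
    and mono: "\<And>S T. S \<in> \<F> \<Longrightarrow> T \<in> \<F> \<Longrightarrow> S \<subseteq> T \<Longrightarrow> \<phi> S \<subseteq> \<phi> T"
    and fibre: "\<And>S. S \<in> \<F> \<Longrightarrow> exact_at K i {T \<in> \<F>. \<phi> T = \<phi> S}"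
  shows "exact_at K i \<F>"
  using assms
proof (induction "card (\<phi> ` \<F>)" arbitrary: \<F>)
  case 0
  then have "\<F> = {}" by simp
  then show ?case by (intro exact_at_if_no_card) simp
next
  case (Suc n)
  have "finite (\<phi> ` \<F>)" "\<phi> ` \<F> \<noteq> {}" using Suc by auto
  then obtain X where X: "X \<in> \<phi> ` \<F>" "\<And>Y. Y \<in> \<phi> ` \<F> \<Longrightarrow> X \<subseteq> Y \<Longrightarrow> Y = X"
    by (metis finite_has_maximal)
  define \<A> where "\<A> = {T \<in> \<F>. \<phi> T \<noteq> X}"
  define \<B> where "\<B> = {T \<in> \<F>. \<phi> T = X}"
  have AB: "\<A> \<union> \<B> = \<F>" by (auto simp: \<A>_def \<B>_def)
  have up: "\<not> S \<subseteq> T" if "S \<in> \<B>" "T \<in> \<A>" for S T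
    using that X(2)[of "\<phi> T"] Suc.prems(4)[of S T] by (auto simp: \<A>_def \<B>_def)
  have "\<phi> ` \<A> = \<phi> ` \<F> - {X}" by (auto simp: \<A>_def)
  then have "card (\<phi> ` \<A>) = n" using X(1) Suc.hyps(2) \<open>finite (\<phi> ` \<F>)\<close> by simp
  moreover have "order_convex \<A>"
    unfolding order_convex_def
  proof (intro ballI allI impI)
    fix R T S assume "R \<in> \<A>" "T \<in> \<A>" "R \<subseteq> S" "S \<subseteq> T"
    then have "S \<in> \<F>" by (intro order_convexD[OF Suc.prems(2), of R T S]) (auto simp: \<A>_def)
    then show "S \<in> \<A>" using up[OF _ \<open>T \<in> \<A>\<close>] \<open>S \<subseteq> T\<close> AB by blast
  qed
  moreover have "exact_at K i {T \<in> \<A>. \<phi> T = \<phi> S}" if "S \<in> \<A>" for S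
  proof -
    have "{T \<in> \<A>. \<phi> T = \<phi> S} = {T \<in> \<F>. \<phi> T = \<phi> S}" using that by (auto simp: \<A>_def)
    then show ?thesis using Suc.prems(5)[of S] that by (simp add: \<A>_def)
  qed
  moreover have "finite \<A>" using Suc.prems(1) by (simp add: \<A>_def)
  moreover have "finite S" if "S \<in> \<A>" for S using Suc.prems(3)[of S] that by (simp add: \<A>_def)
  moreover have "\<phi> S \<subseteq> \<phi> T" if "S \<in> \<A>" "T \<in> \<A>" "S \<subseteq> T" for S T
    using Suc.prems(4)[of S T] that by (simp add: \<A>_def)
  ultimately have "exact_at K i \<A>"
    using Suc.hyps(1)[of \<A>] by blast
  moreover have "exact_at K i \<B>" using X(1) Suc.prems(5) by (auto simp: \<B>_def)
  ultimately have "exact_at K i (\<A> \<union> \<B>)"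
    by (intro exact_at_extension) (simp_all add: AB up Suc.prems)
  then show ?case using AB by simp
qed

subsection \<open>Nerves of half-spaces\<close>

definition fun_convex :: "('a \<Rightarrow> real) set \<Rightarrow> bool" where
  "fun_convex C \<longleftrightarrow> (\<forall>c\<in>C. \<forall>d\<in>C. \<forall>t. 0 \<le> t \<longrightarrow> t \<le> 1 \<longrightarrow> (\<lambda>j. (1 - t) * c j + t * d j) \<in> C)"

lemma fun_convexD:
  "fun_convex C \<Longrightarrow> c \<in> C \<Longrightarrow> d \<in> C \<Longrightarrow> 0 \<le> t \<Longrightarrow> t \<le> 1 \<Longrightarrow>
    (\<lambda>j. (1 - t) * c j + t * d j) \<in> C"
  unfolding fun_convex_def by blast

lemma convex_combination_nonneg:
  fixes x y t :: real
  shows "0 \<le> x \<Longrightarrow> 0 \<le> y \<Longrightarrow> 0 \<le> t \<Longrightarrow> t \<le> 1 \<Longrightarrow> 0 \<le> (1 - t) * x + t * y"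
  by simp

lemma convex_combination_pos:
  fixes x y t :: real
  assumes "0 < x" "0 < y" "0 \<le> t" "t \<le> 1"
  shows "0 < (1 - t) * x + t * y"
proof (cases "t = 1")
  case False
  then have "0 < (1 - t) * x" using assms by simp
  moreover have "0 \<le> t * y" using assms by simp
  ultimately show ?thesis by linarith
qed (use assms in simp)

lemma fun_convex_level:
  assumes "fun_convex C"
  shows "fun_convex {c \<in> C. c w > 0}" "fun_convex {c \<in> C. c w \<le> 0}" "fun_convex {c \<in> C. c w = 0}"
proof -
  show "fun_convex {c \<in> C. c w > 0}"
    using assms convex_combination_pos unfolding fun_convex_def by blast
  show "fun_convex {c \<in> C. c w = 0}"
    using assms unfolding fun_convex_def by simp
  have *: "(1 - t) * x + t * y \<le> 0" if "x \<le> 0" "y \<le> 0" "0 \<le> t" "t \<le> 1" for x y t :: real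
    using convex_combination_nonneg[of "-x" "-y" t] that by simp
  show "fun_convex {c \<in> C. c w \<le> 0}"
    using assms * unfolding fun_convex_def by blast
qed

text \<open>Complements in \<open>X\<close> of the simplices of the nerve of the half-spaces \<open>{c \<in> C. c v > 0}\<close>,
  \<open>v \<in> V\<close>. The empty simplex counts as soon as \<open>C\<close> is nonempty, so exactness means vanishing of
  \<^emph>\<open>reduced\<close> homology.\<close>

definition conerve :: "'a set \<Rightarrow> ('a \<Rightarrow> real) set \<Rightarrow> 'a set \<Rightarrow> 'a set set" where
  "conerve X C V = {S. S \<subseteq> X \<and> X - S \<subseteq> V \<and> (\<exists>c\<in>C. \<forall>v\<in>X - S. c v > 0)}"

lemma conerve_upward: "S \<in> conerve X C V \<Longrightarrow> S \<subseteq> T \<Longrightarrow> T \<subseteq> X \<Longrightarrow> T \<in> conerve X C V"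
  unfolding conerve_def by blast

lemma order_convex_conerve: "order_convex (conerve X C V)"
  unfolding order_convex_def
proof (intro ballI allI impI)
  fix R T S assume "R \<in> conerve X C V" "T \<in> conerve X C V" "R \<subseteq> S" "S \<subseteq> T"
  moreover have "T \<subseteq> X" using \<open>T \<in> conerve X C V\<close> by (simp add: conerve_def)
  ultimately show "S \<in> conerve X C V" using conerve_upward by blast
qed

lemma conerve_drop:
  assumes "\<And>c. c \<in> C \<Longrightarrow> c w \<le> 0"
  shows "conerve X C (insert w V) = conerve X C V"
proof
  show "conerve X C V \<subseteq> conerve X C (insert w V)" unfolding conerve_def by blast
  show "conerve X C (insert w V) \<subseteq> conerve X C V"
  proof
    fix S assume "S \<in> conerve X C (insert w V)"
    then obtain c where S: "S \<subseteq> X" "X - S \<subseteq> insert w V" and c: "c \<in> C" "\<And>v. v \<in> X - S \<Longrightarrow> c v > 0"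
      unfolding conerve_def by blast
    have "w \<notin> X - S" using assms[OF c(1)] c(2)[of w] by force
    then show "S \<in> conerve X C V" using S c unfolding conerve_def by blast
  qed
qed

text \<open>Positivity at \<open>w\<close> is built into the set of functions, so moving
  \<open>w\<close> into or out of a complement costs nothing: the nerve is a cone with apex
  \<open>w\<close>.\<close>

lemma exact_at_conerve_cone:
  fixes K :: "'k::field itself"
  assumes "finite X" "w \<in> X"
  shows "exact_at K i (conerve X {c \<in> C. c w > 0} (insert w V))"
proof (rule exact_at_cone)
  show "finite S" if "S \<in> conerve X {c \<in> C. c w > 0} (insert w V)" for S
    using that assms(1) finite_subset unfolding conerve_def by blast
  show "insert w S \<in> conerve X {c \<in> C. c w > 0} (insert w V) \<longleftrightarrow>
        S - {w} \<in> conerve X {c \<in> C. c w > 0} (insert w V)" (is "?L \<longleftrightarrow> ?R") for S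
  proof
    assume ?L
    then obtain c where c: "insert w S \<subseteq> X" "X - insert w S \<subseteq> insert w V" "c \<in> C" "c w > 0"
      "\<forall>v\<in>X - insert w S. c v > 0"
      unfolding conerve_def by blast
    then have "\<forall>v\<in>X - (S - {w}). c v > 0" by auto
    moreover have "S - {w} \<subseteq> X" "X - (S - {w}) \<subseteq> insert w V" using c(1,2) by blast+
    ultimately show ?R using c(3,4) unfolding conerve_def by blast
  next
    assume ?R
    then show ?L by (rule conerve_upward) (use \<open>?R\<close> assms in \<open>auto simp: conerve_def\<close>)
  qed
qed

text \<open>Both inclusions behind \<open>\<N> \<inter> \<P> = \<Z>\<close> move along segments in
  \<open>C\<close>. A function with \<open>c w = 0\<close> pushed slightly towards \<open>c0\<close>
  keeps its finitely many positive values and becomes positive at \<open>w\<close>; a segment from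
  \<open>c w \<le> 0\<close> to \<open>d w > 0\<close> crosses the hyperplane where the value at
  \<open>w\<close> is zero.\<close>

lemma conerve_split:
  assumes "finite X" "fun_convex C" "w \<in> X" "w \<notin> V" "c0 \<in> C" "c0 w > 0"
  defines "\<P> \<equiv> conerve X {c \<in> C. c w > 0} (insert w V)"
    and "\<N> \<equiv> conerve X {c \<in> C. c w \<le> 0} V"
    and "\<Z> \<equiv> conerve X {c \<in> C. c w = 0} V"
  shows "conerve X C (insert w V) = (\<N> - \<Z>) \<union> \<P>"
    and "\<Z> \<subseteq> \<N>" "(\<N> - \<Z>) \<inter> \<P> = {}"
proof -
  show "\<Z> \<subseteq> \<N>" unfolding \<Z>_def \<N>_def conerve_def by fastforce
  have ZP: "\<Z> \<subseteq> \<P>"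
  proof
    fix S assume "S \<in> \<Z>"
    then obtain c where S: "S \<subseteq> X" "X - S \<subseteq> V" and c: "c \<in> C" "c w = 0" "\<And>v. v \<in> X - S \<Longrightarrow> c v > 0"
      unfolding \<Z>_def conerve_def by blast
    have pos: "eventually (\<lambda>t. (1 - t) * c v + t * c0 v > 0) (at_right 0)" if "v \<in> X - S" for v
    proof -
      have "((\<lambda>t. (1 - t) * c v + t * c0 v) \<longlongrightarrow> (1 - 0) * c v + 0 * c0 v) (at_right 0)"
        by (intro tendsto_intros)
      then show ?thesis using c(3)[OF that] by (intro order_tendstoD(1)) auto
    qed
    have "eventually (\<lambda>t::real. (\<forall>v\<in>X - S. (1 - t) * c v + t * c0 v > 0) \<and> 0 < t \<and> t < 1) (at_right 0)"
      using \<open>finite X\<close> pos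
      by (intro eventually_conj eventually_ball_finite) (auto simp: eventually_at_right_less eventually_at_right_field intro: exI[of _ 1])
    then obtain t :: real where t: "\<And>v. v \<in> X - S \<Longrightarrow> (1 - t) * c v + t * c0 v > 0" "0 < t" "t < 1"
      using eventually_happens'[OF trivial_limit_at_right_real] by blast
    define d where "d j = (1 - t) * c j + t * c0 j" for j
    have "d \<in> {c \<in> C. c w > 0}"
      unfolding d_def using fun_convexD[OF \<open>fun_convex C\<close> c(1) \<open>c0 \<in> C\<close>, of t] t c assms by simp
    moreover have "\<forall>v\<in>X - S. d v > 0" using t(1) by (simp add: d_def)
    ultimately show "S \<in> \<P>" using S unfolding \<P>_def conerve_def by blast
  qed
  have NPZ: "S \<in> \<Z>" if "S \<in> \<N>" "S \<in> \<P>" for S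
  proof -
    obtain c where S: "S \<subseteq> X" "X - S \<subseteq> V" and c: "c \<in> C" "c w \<le> 0" "\<And>v. v \<in> X - S \<Longrightarrow> c v > 0"
      using \<open>S \<in> \<N>\<close> unfolding \<N>_def conerve_def by blast
    obtain d where d: "d \<in> C" "d w > 0" "\<And>v. v \<in> X - S \<Longrightarrow> d v > 0"
      using \<open>S \<in> \<P>\<close> unfolding \<P>_def conerve_def by blast
    \<comment> \<open>The parameter at which the segment from \<open>c\<close> to \<open>d\<close>
      has value zero at \<open>w\<close>.\<close>
    define t where "t = - c w / (d w - c w)"
    have t: "0 \<le> t" "t \<le> 1" using c(2) d(2) by (auto simp: t_def field_simps)
    have "(1 - t) * c w + t * d w = c w + t * (d w - c w)" by (simp add: algebra_simps)
    also have "\<dots> = 0" using c(2) d(2) by (simp add: t_def)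
    finally have 0: "(1 - t) * c w + t * d w = 0" .
    define e where "e j = (1 - t) * c j + t * d j" for j
    have "e \<in> C"
      unfolding e_def by (rule fun_convexD[OF \<open>fun_convex C\<close> c(1) d(1) t])
    moreover have "e v > 0" if "v \<in> X - S" for v
      unfolding e_def using convex_combination_pos[OF c(3)[OF that] d(3)[OF that] t] .
    moreover have "e w = 0" using 0 by (simp add: e_def)
    ultimately show "S \<in> \<Z>" using S unfolding \<Z>_def conerve_def by blast
  qed
  show "(\<N> - \<Z>) \<inter> \<P> = {}" using NPZ by blast
  show "conerve X C (insert w V) = (\<N> - \<Z>) \<union> \<P>"
  proof
    show "(\<N> - \<Z>) \<union> \<P> \<subseteq> conerve X C (insert w V)"
      unfolding \<N>_def \<P>_def conerve_def by blast
    show "conerve X C (insert w V) \<subseteq> (\<N> - \<Z>) \<union> \<P>"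
    proof
      fix S assume "S \<in> conerve X C (insert w V)"
      then obtain c where S: "S \<subseteq> X" "X - S \<subseteq> insert w V" and c: "c \<in> C" "\<And>v. v \<in> X - S \<Longrightarrow> c v > 0"
        unfolding conerve_def by blast
      show "S \<in> (\<N> - \<Z>) \<union> \<P>"
      proof (cases "c w > 0")
        case True
        then show ?thesis using S c unfolding \<P>_def conerve_def by blast
      next
        case False
        then have "w \<notin> X - S" using c(2) by blast
        then have "S \<in> \<N>" using S c False unfolding \<N>_def conerve_def by force
        then show ?thesis using ZP by blast
      qed
    qed
  qed
qed

text \<open>The induction removes one vector \<open>w\<close> at a time: the part of the nerve over \<open>c w > 0\<close> is a cone
  with apex \<open>w\<close>, and what remains is the nerve over \<open>c w \<le> 0\<close> relative to the nerve over \<open>c w = 0\<close>,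
  both of which no longer involve \<open>w\<close>. In the second alternative, \<open>card X - (dim (g ` (X - Z)) + card Z)\<close>
  bounds the dimension of \<open>C\<close>, so the claim is that the nerve has no homology in degrees
  at least that dimension; adding \<open>w\<close> to \<open>Z\<close> lowers the bound by one.\<close>

lemma exact_at_conerve:
  fixes K :: "'k::field itself" and g :: "nat \<Rightarrow> 'v::euclidean_space"
  assumes "finite X" "V \<subseteq> X" "fun_convex C"
    and "(\<forall>c\<in>C. \<exists>v\<in>V. c v > 0) \<or>
      (\<exists>Z\<subseteq>X. (\<forall>c\<in>C. (\<Sum>j\<in>X. c j *\<^sub>R g j) = 0 \<and> (\<forall>z\<in>Z. c z = 0)) \<and>
            i < dim (g ` (X - Z)) + card Z)"
  shows "exact_at K i (conerve X C V)"
proof -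
  have "finite V" using assms(1,2) finite_subset by blast
  then show ?thesis using assms(2-4)
  proof (induction V arbitrary: C i rule: finite_induct)
    case empty
    \<comment> \<open>With no half-spaces left, only the empty simplex can remain, that is
      \<open>S = X\<close>, and only if \<open>C\<close> is nonempty. This rules out the first
      alternative, and the second one forces \<open>i < card X\<close>.\<close>
    have "card S \<noteq> i" if S: "S \<in> conerve X C {}" for S
    proof -
      have "S = X" "C \<noteq> {}" using S unfolding conerve_def by blast+
      then obtain Z where "Z \<subseteq> X" "i < dim (g ` (X - Z)) + card Z" using empty.prems(3) by blast
      moreover have "dim (g ` (X - Z)) \<le> card (X - Z)"
        using dim_le_card'[of "g ` (X - Z)"] card_image_le[of "X - Z" g] \<open>finite X\<close> by fastforce
      moreover have "card (X - Z) + card Z = card X"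
        using \<open>Z \<subseteq> X\<close> \<open>finite X\<close> by (simp add: card_Diff_subset finite_subset[of Z X] card_mono)
      ultimately have "i < card X" by linarith
      then show ?thesis using \<open>S = X\<close> by simp
    qed
    then show ?case by (rule exact_at_if_no_card)
  next
    case (insert w V)
    have wX: "w \<in> X" "V \<subseteq> X" using insert.prems(1) by auto
    show ?case
    proof (cases "\<exists>c0\<in>C. c0 w > 0")
      case False
      then have "conerve X C (insert w V) = conerve X C V" by (intro conerve_drop) force
      moreover have "exact_at K i (conerve X C V)"
        by (rule insert.IH[OF wX(2) insert.prems(2)]) (use insert.prems(3) False in blast)
      ultimately show ?thesis by simp
    next
      case True
      then obtain c0 where c0: "c0 \<in> C" "c0 w > 0" by blast
      define P where "P = conerve X {c \<in> C. c w > 0} (insert w V)"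
      define N where "N = conerve X {c \<in> C. c w \<le> 0} V"
      define Z where "Z = conerve X {c \<in> C. c w = 0} V"
      note split = conerve_split[OF \<open>finite X\<close> insert.prems(2) wX(1) insert.hyps(2) c0,
          folded P_def N_def Z_def]
      have fin: "finite S" if "S \<in> N \<union> P" for S
        using that \<open>finite X\<close> finite_subset unfolding N_def P_def conerve_def by blast
      have "exact_at K i N" unfolding N_def
      proof (rule insert.IH[OF wX(2) fun_convex_level(2)[OF insert.prems(2)]])
        show "(\<forall>c\<in>{c \<in> C. c w \<le> 0}. \<exists>v\<in>V. 0 < c v) \<or>
          (\<exists>Z\<subseteq>X. (\<forall>c\<in>{c \<in> C. c w \<le> 0}. (\<Sum>j\<in>X. c j *\<^sub>R g j) = 0 \<and> (\<forall>z\<in>Z. c z = 0)) \<and>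
            i < dim (g ` (X - Z)) + card Z)"
          using insert.prems(3)
        proof (elim disjE)
          \<comment> \<open>Where \<open>c w \<le> 0\<close>, the half-space containing
            \<open>c\<close> is not that of \<open>w\<close>, so the covering property passes to
            \<open>V\<close>.\<close>
          assume "\<forall>c\<in>C. \<exists>v\<in>insert w V. 0 < c v"
          then show ?thesis by force
        next
          assume "\<exists>Z\<subseteq>X. (\<forall>c\<in>C. (\<Sum>j\<in>X. c j *\<^sub>R g j) = 0 \<and> (\<forall>z\<in>Z. c z = 0)) \<and>
            i < dim (g ` (X - Z)) + card Z"
          then show ?thesis by (intro disjI2) blast
        qed
      qed
      moreover have "exact_at K (Suc i) Z" unfolding Z_def
      proof (rule insert.IH[OF wX(2) fun_convex_level(3)[OF insert.prems(2)]])
        show "(\<forall>c\<in>{c \<in> C. c w = 0}. \<exists>v\<in>V. 0 < c v) \<or>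
          (\<exists>Z\<subseteq>X. (\<forall>c\<in>{c \<in> C. c w = 0}. (\<Sum>j\<in>X. c j *\<^sub>R g j) = 0 \<and> (\<forall>z\<in>Z. c z = 0)) \<and>
            Suc i < dim (g ` (X - Z)) + card Z)"
          using insert.prems(3)
        proof (elim disjE)
          assume "\<forall>c\<in>C. \<exists>v\<in>insert w V. 0 < c v"
          then show ?thesis by force
        next
          assume "\<exists>Z\<subseteq>X. (\<forall>c\<in>C. (\<Sum>j\<in>X. c j *\<^sub>R g j) = 0 \<and> (\<forall>z\<in>Z. c z = 0)) \<and>
            i < dim (g ` (X - Z)) + card Z"
          then obtain Z where Z: "Z \<subseteq> X" "\<And>c. c \<in> C \<Longrightarrow> (\<Sum>j\<in>X. c j *\<^sub>R g j) = 0"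
            "\<And>c z. c \<in> C \<Longrightarrow> z \<in> Z \<Longrightarrow> c z = 0" "i < dim (g ` (X - Z)) + card Z"
            by blast
          have "w \<notin> Z" using Z(3)[OF c0(1), of w] c0(2) by auto
          have "finite Z" using Z(1) \<open>finite X\<close> finite_subset by blast
          let ?Y = "X - insert w Z"
          have X: "X = insert w (?Y \<union> Z)" using wX Z(1) by auto
          \<comment> \<open>The relation \<open>c0\<close> has a nonzero coefficient at
            \<open>w\<close>, so \<open>g w\<close> depends on the remaining vectors. Moving
            \<open>w\<close> into \<open>Z\<close> therefore keeps the dimension and raises the
            cardinality by one, which pays for the shift to degree \<open>Suc i\<close>.\<close>
          have "0 = (\<Sum>j\<in>X. c0 j *\<^sub>R g j)" using Z(2) c0 by simp
          also have "\<dots> = (\<Sum>j\<in>insert w ?Y. c0 j *\<^sub>R g j)"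
            by (rule sum.mono_neutral_right) (use \<open>finite X\<close> wX Z(3) c0 in auto)
          also have "\<dots> = c0 w *\<^sub>R g w + (\<Sum>j\<in>?Y. c0 j *\<^sub>R g j)"
            using \<open>finite X\<close> by simp
          finally have "c0 w *\<^sub>R g w = - (\<Sum>j\<in>?Y. c0 j *\<^sub>R g j)"
            by (simp add: eq_neg_iff_add_eq_0)
          then have "g w = (1 / c0 w) *\<^sub>R (- (\<Sum>j\<in>?Y. c0 j *\<^sub>R g j))"
            using c0(2) by (metis divide_self_if less_irrefl scaleR_one scaleR_scaleR times_divide_eq_left mult_1)
          also have "\<dots> \<in> span (g ` ?Y)"
            by (intro span_mul span_neg span_sum) (auto intro: span_base)
          finally have gw: "g w \<in> span (g ` ?Y)" .
          have "g ` (X - Z) = insert (g w) (g ` ?Y)" using wX \<open>w \<notin> Z\<close> by auto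
          then have "dim (g ` (X - Z)) = dim (g ` ?Y)"
            using gw by (metis dim_span span_redundant)
          then have "Suc i < dim (g ` ?Y) + card (insert w Z)"
            using Z(4) \<open>w \<notin> Z\<close> \<open>finite Z\<close> by simp
          then show ?thesis
            using Z(1-3) wX by (intro disjI2 exI[of _ "insert w Z"]) auto
        qed
      qed
      moreover have NZ: "(N - Z) \<union> Z = N" using split(2) by auto
      moreover have upZ: "\<not> S \<subseteq> T" if "S \<in> Z" "T \<in> N - Z" for S T
      proof
        assume "S \<subseteq> T"
        have "T \<subseteq> X" using that unfolding N_def conerve_def by blast
        then have "T \<in> Z" using that \<open>S \<subseteq> T\<close> conerve_upward unfolding Z_def by blast
        with that show False by blast
      qed
      ultimately have "exact_at K i (N - Z)"
        using exact_at_lower_part[of "N - Z" Z K i] fin order_convex_conerve[of X "{c \<in> C. c w \<le> 0}" V]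
        unfolding N_def[symmetric] NZ by blast
      moreover have "exact_at K i P"
        unfolding P_def by (rule exact_at_conerve_cone[OF \<open>finite X\<close> wX(1)])
      moreover have "\<not> S \<subseteq> T" if "S \<in> P" "T \<in> N - Z" for S T
      proof
        assume "S \<subseteq> T"
        have "T \<subseteq> X" using that unfolding N_def conerve_def by blast
        then have "T \<in> P" using that \<open>S \<subseteq> T\<close> conerve_upward unfolding P_def by blast
        with that split(3) show False by blast
      qed
      moreover have "order_convex ((N - Z) \<union> P)"
        unfolding split(1)[symmetric] by (rule order_convex_conerve)
      ultimately have "exact_at K i ((N - Z) \<union> P)"
        using fin by (intro exact_at_extension) auto
      then show ?thesis using split(1) by simp
    qed
  qed
qed

subsection \<open>Smallest faces\<close>

definition feasible :: "('a \<Rightarrow> 'v::real_vector) \<Rightarrow> 'a set \<Rightarrow> 'v \<Rightarrow> 'a set \<Rightarrow> ('a \<Rightarrow> real) \<Rightarrow> bool" where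
  "feasible g I b S c \<longleftrightarrow> (\<Sum>j\<in>I. c j *\<^sub>R g j) = b \<and> (\<forall>j\<in>I - S. c j \<ge> 0)"

text \<open>For \<open>b \<in> cone(g) + span(g ` S)\<close> this is the set of generators on the smallest face
  containing \<open>g ` S\<close> that contains \<open>b\<close> modulo \<open>span(g ` S)\<close>.\<close>

definition reach :: "('a \<Rightarrow> 'v::real_vector) \<Rightarrow> 'a set \<Rightarrow> 'v \<Rightarrow> 'a set \<Rightarrow> 'a set" where
  "reach g I b S = S \<union> {v\<in>I. \<exists>c. feasible g I b S c \<and> c v > 0}"

lemma feasible_mono: "feasible g I b S c \<Longrightarrow> S \<subseteq> T \<Longrightarrow> feasible g I b T c"
  unfolding feasible_def by blast

lemma reach_mono: "S \<subseteq> T \<Longrightarrow> reach g I b S \<subseteq> reach g I b T"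
  unfolding reach_def using feasible_mono by blast

lemma reach_superset: "S \<subseteq> reach g I b S"
  unfolding reach_def by blast

lemma reach_subset: "S \<subseteq> I \<Longrightarrow> reach g I b S \<subseteq> I"
  unfolding reach_def by blast

lemma feasible_zero_outside_reach:
  "feasible g I b S c \<Longrightarrow> j \<in> I - reach g I b S \<Longrightarrow> c j = 0"
  unfolding reach_def by (force simp: feasible_def)

lemma feasible_average:
  assumes "feasible g I b S c" "feasible g I b S d"
  shows "feasible g I b S (\<lambda>j. (c j + d j) / 2)"
proof -
  have "(\<Sum>j\<in>I. ((c j + d j) / 2) *\<^sub>R g j) = (1/2) *\<^sub>R (\<Sum>j\<in>I. c j *\<^sub>R g j) + (1/2) *\<^sub>R (\<Sum>j\<in>I. d j *\<^sub>R g j)"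
    by (simp add: scaleR_left_distrib add_divide_distrib sum.distrib scaleR_sum_right)
  also have "\<dots> = (1/2) *\<^sub>R b + (1/2) *\<^sub>R b"
    using assms by (simp add: feasible_def)
  also have "\<dots> = b" by (simp add: scaleR_left_distrib[symmetric])
  finally show ?thesis using assms by (simp add: feasible_def)
qed

text \<open>A relative interior point: averaging the witnesses for single indices makes all
  coordinates in \<open>reach g I b S - S\<close> positive at once.\<close>

lemma feasible_positive_on_reach:
  assumes "finite I" "S \<subseteq> I" "feasible g I b S c0"
  obtains c where "feasible g I b S c" "\<And>j. j \<in> reach g I b S - S \<Longrightarrow> c j > 0"
proof -
  have "finite W \<Longrightarrow> W \<subseteq> reach g I b S - S \<Longrightarrow> \<exists>c. feasible g I b S c \<and> (\<forall>j\<in>W. c j > 0)" for W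
  proof (induction W rule: finite_induct)
    case empty
    then show ?case using assms(3) by blast
  next
    case (insert w W)
    then obtain c where c: "feasible g I b S c" "\<forall>j\<in>W. c j > 0" by blast
    obtain d where d: "feasible g I b S d" "d w > 0"
      using insert.prems unfolding reach_def by blast
    have nonneg: "c j \<ge> 0" "d j \<ge> 0" if "j \<in> insert w W" for j
      using that insert.prems reach_subset[OF assms(2), of g b] c(1) d(1) unfolding feasible_def by blast+
    have "(c j + d j) / 2 > 0" if "j \<in> insert w W" for j
    proof (cases "j = w")
      case True
      then show ?thesis using nonneg(1)[OF that] d(2) by simp
    next
      case False
      then show ?thesis using nonneg(2)[OF that] c(2) that by (simp add: add_pos_nonneg)
    qed
    then show ?case
      using feasible_average[OF c(1) d(1)] by (intro exI[of _ "\<lambda>j. (c j + d j) / 2"]) simp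
  qed
  moreover have "finite (reach g I b S - S)"
    using finite_subset[OF reach_subset[OF assms(2), of g b] assms(1)] by simp
  ultimately have "\<exists>c. feasible g I b S c \<and> (\<forall>j\<in>reach g I b S - S. c j > 0)" by simp
  then show ?thesis using that by blast
qed

text \<open>The face property of \<open>reach\<close>. A small positive multiple of \<open>e\<close>
  can be added to a feasible point that is strictly positive on \<open>reach g I b S - S\<close>; if
  \<open>e v\<close> were positive, the result would witness that \<open>v\<close> is in
  \<open>reach g I b S\<close> after all.\<close>

lemma relation_zero_outside_reach:
  fixes e :: "'a \<Rightarrow> real"
  assumes I: "finite I" "S \<subseteq> I" and feas: "feasible g I b S c0"
    and e: "(\<Sum>j\<in>I. e j *\<^sub>R g j) = 0" "\<And>j. j \<in> I - reach g I b S \<Longrightarrow> e j \<ge> 0"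
    and v: "v \<in> I - reach g I b S"
  shows "e v = 0"
proof (rule ccontr)
  assume "e v \<noteq> 0"
  then have ev: "e v > 0" using e(2)[OF v] by simp
  obtain c where c: "feasible g I b S c" "\<And>j. j \<in> reach g I b S - S \<Longrightarrow> c j > 0"
    using feasible_positive_on_reach[OF I feas] by blast
  have pos: "eventually (\<lambda>t. c j + t * e j > 0) (at_right 0)" if "j \<in> reach g I b S - S" for j
  proof -
    have "((\<lambda>t. c j + t * e j) \<longlongrightarrow> c j + 0 * e j) (at_right 0)"
      by (intro tendsto_intros)
    then show ?thesis using c(2)[OF that] by (intro order_tendstoD(1)) auto
  qed
  have fin: "finite (reach g I b S - S)"
    using finite_subset[OF reach_subset[OF I(2), of g b] I(1)] by simp
  have "eventually (\<lambda>t::real. (\<forall>j\<in>reach g I b S - S. c j + t * e j > 0) \<and> 0 < t) (at_right 0)"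
    using pos fin
    by (intro eventually_conj eventually_ball_finite) (auto simp: eventually_at_right_less)
  then obtain t :: real where t: "\<And>j. j \<in> reach g I b S - S \<Longrightarrow> c j + t * e j > 0" "0 < t"
    using eventually_happens'[OF trivial_limit_at_right_real] by blast
  have "(\<Sum>j\<in>I. (c j + t * e j) *\<^sub>R g j) = (\<Sum>j\<in>I. c j *\<^sub>R g j) + t *\<^sub>R (\<Sum>j\<in>I. e j *\<^sub>R g j)"
    by (simp add: scaleR_left_distrib sum.distrib scaleR_sum_right)
  then have sum: "(\<Sum>j\<in>I. (c j + t * e j) *\<^sub>R g j) = b"
    using e(1) c(1) by (simp add: feasible_def)
  have "c j + t * e j \<ge> 0" if "j \<in> I - S" for j
  proof (cases "j \<in> reach g I b S")
    case True
    then show ?thesis using t(1)[of j] that by simp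
  next
    case False
    then show ?thesis using e(2)[of j] t(2) that c(1) by (simp add: feasible_def)
  qed
  then have "feasible g I b S (\<lambda>j. c j + t * e j)" using sum by (simp add: feasible_def)
  moreover have "c v + t * e v > 0"
    using ev t(2) feasible_zero_outside_reach[OF c(1) v] by simp
  ultimately have "v \<in> reach g I b S" using v unfolding reach_def by blast
  with v show False by blast
qed

lemma sum_extend_by_zero:
  fixes g :: "'a \<Rightarrow> 'v::real_vector" and c :: "'a \<Rightarrow> real"
  assumes "finite I" "X \<subseteq> I"
  shows "(\<Sum>j\<in>I. (if j \<in> X then c j else 0) *\<^sub>R g j) = (\<Sum>j\<in>X. c j *\<^sub>R g j)"
proof -
  have "(\<Sum>j\<in>I. (if j \<in> X then c j else 0) *\<^sub>R g j) = (\<Sum>j\<in>I. if j \<in> X then c j *\<^sub>R g j else 0)"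
    by (intro sum.cong) auto
  also have "\<dots> = (\<Sum>j\<in>I \<inter> X. c j *\<^sub>R g j)" using assms(1) by (rule sum.inter_restrict[symmetric])
  also have "I \<inter> X = X" using assms(2) by blast
  finally show ?thesis .
qed

text \<open>A function that is positive on \<open>X - S\<close> certifies that \<open>S\<close>
  reaches all of \<open>X\<close>, and the face property prevents it from reaching more. Conversely,
  a relative interior point for \<open>S\<close> is positive on \<open>X - S\<close> and vanishes
  off \<open>X\<close>.\<close>

lemma conerve_eq_reach_fibre:
  assumes I: "finite I" "S0 \<subseteq> I" and feas: "feasible g I b S0 c0"
    and X: "reach g I b S0 = X"
  shows "conerve X {c. (\<Sum>j\<in>X. c j *\<^sub>R g j) = b} X =
    {S. S \<subseteq> I \<and> reach g I b S = X \<and> (\<exists>c. feasible g I b S c)}"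
proof (intro set_eqI iffI)
  have XI: "X \<subseteq> I" using X reach_subset[OF I(2)] by blast
  fix S
  {
    assume "S \<in> conerve X {c. (\<Sum>j\<in>X. c j *\<^sub>R g j) = b} X"
    then obtain c where S: "S \<subseteq> X" and c: "(\<Sum>j\<in>X. c j *\<^sub>R g j) = b" "\<And>v. v \<in> X - S \<Longrightarrow> c v > 0"
      unfolding conerve_def by blast
    define c' where "c' j = (if j \<in> X then c j else 0)" for j
    have sum': "(\<Sum>j\<in>I. c' j *\<^sub>R g j) = b"
      unfolding c'_def sum_extend_by_zero[OF I(1) XI] by (rule c(1))
    have "c' j \<ge> 0" if "j \<in> I - S" for j
      using c(2)[of j] that by (auto simp: c'_def intro: less_imp_le)
    then have c': "feasible g I b S c'" using sum' by (simp add: feasible_def)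
    have "X \<subseteq> reach g I b S"
    proof
      fix v assume "v \<in> X"
      show "v \<in> reach g I b S"
      proof (cases "v \<in> S")
        case True
        then show ?thesis using reach_superset[of S g I b] by blast
      next
        case False
        then have "c' v > 0" using c(2)[of v] \<open>v \<in> X\<close> by (simp add: c'_def)
        then show ?thesis using c' \<open>v \<in> X\<close> XI unfolding reach_def by blast
      qed
    qed
    moreover have "v \<in> X" if v: "v \<in> reach g I b S" for v
    proof (rule ccontr)
      assume "v \<notin> X"
      then obtain d where d: "v \<in> I" "feasible g I b S d" "d v > 0"
        using v S unfolding reach_def by blast
      \<comment> \<open>Both functions represent \<open>b\<close>, so their difference is a
        relation; it is nonnegative off \<open>X\<close> because \<open>c'\<close> vanishes there
        and \<open>S\<close> lies inside \<open>X\<close>.\<close>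
      have "d v - c' v = 0"
      proof (rule relation_zero_outside_reach[OF I feas])
        show "(\<Sum>j\<in>I. (d j - c' j) *\<^sub>R g j) = 0"
          using sum' d(2) by (simp add: feasible_def scaleR_left_diff_distrib sum_subtractf)
        show "v \<in> I - reach g I b S0" using \<open>v \<notin> X\<close> X d(1) by blast
        show "d j - c' j \<ge> 0" if "j \<in> I - reach g I b S0" for j
          using that d(2) S X by (auto simp: c'_def feasible_def)
      qed
      then show False using d(3) \<open>v \<notin> X\<close> by (simp add: c'_def)
    qed
    ultimately show "S \<in> {S. S \<subseteq> I \<and> reach g I b S = X \<and> (\<exists>c. feasible g I b S c)}"
      using S XI c' by blast
  next
    assume "S \<in> {S. S \<subseteq> I \<and> reach g I b S = X \<and> (\<exists>c. feasible g I b S c)}"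
    then obtain d where S: "S \<subseteq> I" "reach g I b S = X" and d: "feasible g I b S d" by blast
    obtain c where c: "feasible g I b S c" "\<And>j. j \<in> reach g I b S - S \<Longrightarrow> c j > 0"
      using feasible_positive_on_reach[OF I(1) S(1) d] by blast
    have "(\<Sum>j\<in>X. c j *\<^sub>R g j) = (\<Sum>j\<in>I. c j *\<^sub>R g j)"
      by (rule sum.mono_neutral_left[OF I(1) XI])
         (use feasible_zero_outside_reach[OF c(1)] S(2) in auto)
    also have "\<dots> = b" using c(1) by (simp add: feasible_def)
    finally show "S \<in> conerve X {c. (\<Sum>j\<in>X. c j *\<^sub>R g j) = b} X"
      using reach_superset[of S g I b] c(2) S unfolding conerve_def by blast
  }
qed

lemma fun_convex_affine:
  fixes g :: "'a \<Rightarrow> 'v::real_vector"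
  shows "fun_convex {c. (\<Sum>j\<in>X. c j *\<^sub>R g j) = b}"
  unfolding fun_convex_def
proof (intro ballI allI impI)
  fix c d and t :: real
  assume "c \<in> {c. (\<Sum>j\<in>X. c j *\<^sub>R g j) = b}" "d \<in> {c. (\<Sum>j\<in>X. c j *\<^sub>R g j) = b}"
  moreover have "(\<Sum>j\<in>X. ((1 - t) * c j + t * d j) *\<^sub>R g j) =
      (1 - t) *\<^sub>R (\<Sum>j\<in>X. c j *\<^sub>R g j) + t *\<^sub>R (\<Sum>j\<in>X. d j *\<^sub>R g j)"
    by (simp only: scaleR_sum_right sum.distrib[symmetric] scaleR_left_distrib scaleR_scaleR)
  ultimately show "(\<lambda>j. (1 - t) * c j + t * d j) \<in> {c. (\<Sum>j\<in>X. c j *\<^sub>R g j) = b}"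
    by (simp add: scaleR_left_distrib[symmetric])
qed

subsection \<open>Integer combinations and localisations\<close>

lemma rvec_add: "rvec (x + y) = rvec x + rvec y"
  by (simp add: rvec_def vec_eq_iff)

lemma rvec_minus: "rvec (- x) = - rvec x"
  by (simp add: rvec_def vec_eq_iff)

lemma rvec_0: "rvec 0 = 0"
  by (simp add: rvec_def vec_eq_iff)

lemma rvec_scale: "rvec (k *s x) = of_int k *\<^sub>R rvec x"
  by (simp add: rvec_def vec_eq_iff)

lemma rvec_sum: "rvec (\<Sum>j\<in>X. f j) = (\<Sum>j\<in>X. rvec (f j))"
  by (induction X rule: infinite_finite_induct) (simp_all add: rvec_0 rvec_add)

definition int_comb :: "(int^'n) list \<Rightarrow> nat set \<Rightarrow> (nat \<Rightarrow> int) \<Rightarrow> int^'n" where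
  "int_comb gs X k = (\<Sum>j\<in>X. k j *s gs ! j)"

lemma rvec_int_comb:
  "rvec (int_comb gs X k) = (\<Sum>j\<in>X. real_of_int (k j) *\<^sub>R rvec (gs ! j))"
  by (simp add: int_comb_def rvec_sum rvec_scale)

lemma int_comb_add: "int_comb gs X (\<lambda>j. k j + l j) = int_comb gs X k + int_comb gs X l"
  by (simp add: int_comb_def vector_sadd_rdistrib sum.distrib)

lemma int_comb_diff: "int_comb gs X (\<lambda>j. k j - l j) = int_comb gs X k - int_comb gs X l"
  by (simp add: int_comb_def vector_sub_rdistrib sum_subtractf)

lemma int_comb_scale: "int_comb gs X (\<lambda>j. c * k j) = c *s int_comb gs X k"
  by (simp add: int_comb_def vec_eq_iff sum_distrib_left mult.assoc)

lemma int_comb_extend: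
  assumes "finite I" "X \<subseteq> I"
  shows "int_comb gs I (\<lambda>j. if j \<in> X then k j else 0) = int_comb gs X k"
proof -
  have "int_comb gs I (\<lambda>j. if j \<in> X then k j else 0) = (\<Sum>j\<in>I. if j \<in> X then k j *s gs ! j else 0)"
    unfolding int_comb_def by (intro sum.cong) auto
  also have "\<dots> = (\<Sum>j\<in>I \<inter> X. k j *s gs ! j)" using assms(1) by (rule sum.inter_restrict[symmetric])
  also have "I \<inter> X = X" using assms(2) by blast
  finally show ?thesis by (simp add: int_comb_def)
qed

lemma int_comb_cong:
  "(\<And>j. j \<in> X \<Longrightarrow> k j = l j) \<Longrightarrow> int_comb gs X k = int_comb gs X l"
  unfolding int_comb_def by (intro sum.cong) auto

lemma int_comb_shrink:
  assumes "finite I" "X \<subseteq> I" "\<And>j. j \<in> I - X \<Longrightarrow> k j = 0"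
  shows "int_comb gs I k = int_comb gs X k"
  unfolding int_comb_extend[OF assms(1,2), symmetric] by (rule int_comb_cong) (use assms(3) in auto)

lemma monoid_gen_iff:
  assumes "distinct gs"
  shows "x \<in> monoid_gen (set gs) \<longleftrightarrow>
    (\<exists>k. (\<forall>j<length gs. k j \<ge> 0) \<and> x = int_comb gs {..<length gs} k)"
proof
  note bij = bij_betw_nth[OF assms refl refl]
  {
    assume "x \<in> monoid_gen (set gs)"
    then obtain S c where S: "S \<subseteq> set gs" "x = (\<Sum>g\<in>S. of_nat (c g :: nat) *s g)"
      unfolding monoid_gen_def by blast
    have "x = (\<Sum>g\<in>set gs \<inter> S. of_nat (c g) *s g)" using S by (simp add: Int_absorb1)
    also have "\<dots> = (\<Sum>g\<in>set gs. if g \<in> S then of_nat (c g) *s g else 0)"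
      by (rule sum.inter_restrict) simp
    also have "\<dots> = (\<Sum>g\<in>set gs. (if g \<in> S then of_nat (c g) else 0) *s g)"
      by (intro sum.cong) auto
    also have "\<dots> = (\<Sum>j<length gs. (if gs ! j \<in> S then of_nat (c (gs ! j)) else 0) *s gs ! j)"
      by (rule sum.reindex_bij_betw[OF bij, symmetric])
    finally show "\<exists>k. (\<forall>j<length gs. k j \<ge> 0) \<and> x = int_comb gs {..<length gs} k"
      unfolding int_comb_def
      by (intro exI[of _ "\<lambda>j. if gs ! j \<in> S then of_nat (c (gs ! j)) else 0"]) simp
  next
    assume "\<exists>k. (\<forall>j<length gs. k j \<ge> 0) \<and> x = int_comb gs {..<length gs} k"
    then obtain k where k: "\<And>j. j < length gs \<Longrightarrow> k j \<ge> 0" "x = int_comb gs {..<length gs} k" by blast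
    define c where "c g = nat (k (inv_into {..<length gs} ((!) gs) g))" for g
    have c: "c (gs ! j) = nat (k j)" if "j < length gs" for j
      using that bij unfolding c_def bij_betw_def by (simp add: inv_into_f_f)
    have "x = (\<Sum>j<length gs. of_nat (c (gs ! j)) *s gs ! j)"
      unfolding k(2) int_comb_def by (intro sum.cong) (use k(1) c in auto)
    also have "\<dots> = (\<Sum>g\<in>set gs. of_nat (c g) *s g)"
      by (rule sum.reindex_bij_betw[OF bij])
    finally show "x \<in> monoid_gen (set gs)" unfolding monoid_gen_def by blast
  }
qed

text \<open>Inverting the generators indexed by \<open>S\<close> frees the signs of exactly their
  coefficients. This makes localisations comparable with the real condition
  \<open>feasible\<close>.\<close>

lemma Mloc_iff:
  assumes "distinct gs" "S \<subseteq> {..<length gs}"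
  shows "a \<in> Mloc (monoid_gen (set gs)) gs S \<longleftrightarrow>
    (\<exists>k. (\<forall>j\<in>{..<length gs} - S. k j \<ge> 0) \<and> a = int_comb gs {..<length gs} k)"
proof
  assume "a \<in> Mloc (monoid_gen (set gs)) gs S"
  then obtain x k where x: "x \<in> monoid_gen (set gs)" "a = x + int_comb gs S k"
    unfolding Mloc_def int_comb_def by auto
  obtain n where n: "\<forall>j<length gs. n j \<ge> 0" "x = int_comb gs {..<length gs} n"
    using x(1) unfolding monoid_gen_iff[OF assms(1)] by blast
  have "a = int_comb gs {..<length gs} (\<lambda>j. n j + (if j \<in> S then k j else 0))"
    using x(2) n(2) by (simp add: int_comb_add int_comb_extend[OF _ assms(2)])
  then show "\<exists>k. (\<forall>j\<in>{..<length gs} - S. k j \<ge> 0) \<and> a = int_comb gs {..<length gs} k"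
    using n(1) by (intro exI[of _ "\<lambda>j. n j + (if j \<in> S then k j else 0)"]) simp
next
  assume "\<exists>k. (\<forall>j\<in>{..<length gs} - S. k j \<ge> 0) \<and> a = int_comb gs {..<length gs} k"
  then obtain k where k: "\<forall>j\<in>{..<length gs} - S. k j \<ge> 0" "a = int_comb gs {..<length gs} k" by blast
  define n where "n j = (if j \<in> S then 0 else k j)" for j
  have "a = int_comb gs {..<length gs} (\<lambda>j. n j + (if j \<in> S then k j else 0))"
    unfolding k(2) n_def by (rule int_comb_cong) simp
  also have "\<dots> = int_comb gs {..<length gs} n + int_comb gs S k"
    by (simp add: int_comb_add int_comb_extend[OF _ assms(2)])
  finally have a: "a = int_comb gs {..<length gs} n + int_comb gs S k" .
  have "int_comb gs {..<length gs} n \<in> monoid_gen (set gs)"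
    unfolding monoid_gen_iff[OF assms(1)] using k(1) by (intro exI[of _ n]) (simp add: n_def)
  then show "a \<in> Mloc (monoid_gen (set gs)) gs S"
    using a unfolding Mloc_def int_comb_def by auto
qed

text \<open>Splitting \<open>k\<close> into positive and negative parts gives a difference of two
  monoid elements in \<open>F\<close>. It serves the face in \<open>face_of_reach\<close> and, with
  \<open>F = UNIV\<close>, the whole group.\<close>

lemma int_comb_in_gp:
  assumes gs: "distinct gs" and X: "X \<subseteq> {..<length gs}"
    and closed: "\<And>n. (\<And>j. j \<in> X \<Longrightarrow> n j \<ge> 0) \<Longrightarrow> rvec (int_comb gs X n) \<in> F"
  shows "int_comb gs X k \<in> gp {y \<in> monoid_gen (set gs). rvec y \<in> F}"
proof -
  have mem: "int_comb gs X n \<in> {y \<in> monoid_gen (set gs). rvec y \<in> F}"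
    if "\<And>j. j \<in> X \<Longrightarrow> n j \<ge> 0" for n
  proof -
    have "int_comb gs X n = int_comb gs {..<length gs} (\<lambda>j. if j \<in> X then n j else 0)"
      using X by (simp add: int_comb_extend)
    then have "int_comb gs X n \<in> monoid_gen (set gs)"
      unfolding monoid_gen_iff[OF gs] using that
      by (intro exI[of _ "\<lambda>j. if j \<in> X then n j else 0"]) simp
    then show ?thesis using closed[OF that] by simp
  qed
  have "int_comb gs X k = int_comb gs X (\<lambda>j. max (k j) 0) - int_comb gs X (\<lambda>j. max (- k j) 0)"
    unfolding int_comb_diff[symmetric] by (rule int_comb_cong) simp
  moreover have "int_comb gs X (\<lambda>j. max (k j) 0) \<in> {y \<in> monoid_gen (set gs). rvec y \<in> F}"
    "int_comb gs X (\<lambda>j. max (- k j) 0) \<in> {y \<in> monoid_gen (set gs). rvec y \<in> F}"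
    by (intro mem; simp)+
  ultimately show ?thesis unfolding gp_def by blast
qed

lemma gp_iff:
  assumes "distinct gs"
  shows "a \<in> gp (monoid_gen (set gs)) \<longleftrightarrow> (\<exists>k. a = int_comb gs {..<length gs} k)"
proof
  assume "a \<in> gp (monoid_gen (set gs))"
  then obtain x y where xy: "x \<in> monoid_gen (set gs)" "y \<in> monoid_gen (set gs)" "a = x - y"
    unfolding gp_def by blast
  obtain k where "x = int_comb gs {..<length gs} k"
    using xy(1) unfolding monoid_gen_iff[OF assms] by blast
  moreover obtain l where "y = int_comb gs {..<length gs} l"
    using xy(2) unfolding monoid_gen_iff[OF assms] by blast
  ultimately have "a = int_comb gs {..<length gs} (\<lambda>j. k j - l j)"
    using xy(3) by (simp add: int_comb_diff)
  then show "\<exists>k. a = int_comb gs {..<length gs} k" by blast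
next
  assume "\<exists>k. a = int_comb gs {..<length gs} k"
  then show "a \<in> gp (monoid_gen (set gs))"
    using int_comb_in_gp[OF assms subset_refl, of UNIV] by auto
qed

lemma cn_monoid_gen:
  assumes "distinct gs"
  shows "x \<in> cn (monoid_gen (set gs)) \<longleftrightarrow>
    (\<exists>c. (\<forall>j<length gs. c j \<ge> 0) \<and> x = (\<Sum>j<length gs. c j *\<^sub>R rvec (gs ! j)))"
proof
  note bij = bij_betw_nth[OF assms refl refl]
  {
    assume "x \<in> cn (monoid_gen (set gs))"
    then obtain S c where S: "S \<subseteq> monoid_gen (set gs)" "\<And>s. s \<in> S \<Longrightarrow> c s \<ge> (0::real)"
      and x: "x = (\<Sum>s\<in>S. c s *\<^sub>R rvec s)"
      unfolding cn_def by blast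
    have "\<forall>s\<in>S. \<exists>k. (\<forall>j<length gs. k j \<ge> 0) \<and> s = int_comb gs {..<length gs} k"
      using S(1) monoid_gen_iff[OF assms] by blast
    then obtain k where k: "\<And>s. s \<in> S \<Longrightarrow> (\<forall>j<length gs. k s j \<ge> 0) \<and> s = int_comb gs {..<length gs} (k s)"
      by metis
    have "x = (\<Sum>s\<in>S. c s *\<^sub>R rvec (int_comb gs {..<length gs} (k s)))"
      unfolding x by (intro sum.cong refl arg_cong2[where f=scaleR] arg_cong[where f=rvec]) (use k in blast)
    also have "\<dots> = (\<Sum>s\<in>S. \<Sum>j<length gs. (c s * real_of_int (k s j)) *\<^sub>R rvec (gs ! j))"
      by (simp add: rvec_int_comb scaleR_sum_right)
    also have "\<dots> = (\<Sum>j<length gs. (\<Sum>s\<in>S. c s * real_of_int (k s j)) *\<^sub>R rvec (gs ! j))"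
      by (subst sum.swap) (simp add: scaleR_sum_left)
    finally have "x = (\<Sum>j<length gs. (\<Sum>s\<in>S. c s * real_of_int (k s j)) *\<^sub>R rvec (gs ! j))" .
    moreover have "(\<Sum>s\<in>S. c s * real_of_int (k s j)) \<ge> 0" if "j < length gs" for j
      by (intro sum_nonneg mult_nonneg_nonneg) (use S(2) k that in auto)
    ultimately show "\<exists>c. (\<forall>j<length gs. c j \<ge> 0) \<and> x = (\<Sum>j<length gs. c j *\<^sub>R rvec (gs ! j))"
      by (intro exI[of _ "\<lambda>j. \<Sum>s\<in>S. c s * real_of_int (k s j)"]) simp
  next
    assume "\<exists>c. (\<forall>j<length gs. c j \<ge> 0) \<and> x = (\<Sum>j<length gs. c j *\<^sub>R rvec (gs ! j))"
    then obtain c where c: "\<And>j. j < length gs \<Longrightarrow> c j \<ge> 0" "x = (\<Sum>j<length gs. c j *\<^sub>R rvec (gs ! j))"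
      by blast
    define d where "d g = c (inv_into {..<length gs} ((!) gs) g)" for g
    have d: "d (gs ! j) = c j" if "j < length gs" for j
      using that bij unfolding d_def bij_betw_def by (simp add: inv_into_f_f)
    have "x = (\<Sum>j<length gs. d (gs ! j) *\<^sub>R rvec (gs ! j))"
      unfolding c(2) by (intro sum.cong) (use d in auto)
    also have "\<dots> = (\<Sum>g\<in>set gs. d g *\<^sub>R rvec g)"
      by (rule sum.reindex_bij_betw[OF bij])
    finally have "x = (\<Sum>g\<in>set gs. d g *\<^sub>R rvec g)" .
    moreover have "d s \<ge> 0" if s: "s \<in> set gs" for s
    proof -
      obtain j where "j < length gs" "s = gs ! j" using s unfolding in_set_conv_nth by blast
      then show ?thesis using d c(1) by simp
    qed
    moreover have "set gs \<subseteq> monoid_gen (set gs)"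
    proof
      fix s assume "s \<in> set gs"
      moreover have "s = (\<Sum>g\<in>{s}. of_nat 1 *s g)" by simp
      ultimately show "s \<in> monoid_gen (set gs)"
        unfolding monoid_gen_def by (intro CollectI exI[of _ "{s}"] exI[of _ "\<lambda>_. 1"]) simp
    qed
    ultimately show "x \<in> cn (monoid_gen (set gs))"
      unfolding cn_def by (intro CollectI exI[of _ "set gs"] exI[of _ d]) simp
  }
qed

section \<open>Rounding real combinations and seminormality of localisations\<close>

lemma finite_bounded_int_vec: "finite {v :: int^'n. \<forall>i. \<bar>v $ i\<bar> \<le> b}"
proof (rule finite_imageD)
  show "inj_on vec_nth {v :: int^'n. \<forall>i. \<bar>v $ i\<bar> \<le> b}"
    by (auto simp: inj_on_def vec_eq_iff)
  have "vec_nth ` {v :: int^'n. \<forall>i. \<bar>v $ i\<bar> \<le> b} \<subseteq> PiE UNIV (\<lambda>_. {-b..b})"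
    by (auto simp: abs_le_iff minus_le_iff)
  moreover have "finite (PiE (UNIV :: 'n set) (\<lambda>_. {-b..b}))"
    by (rule finite_PiE) auto
  ultimately show "finite (vec_nth ` {v :: int^'n. \<forall>i. \<bar>v $ i\<bar> \<le> b})"
    by (rule finite_subset)
qed

text \<open>Rounding the real coefficients of \<open>N a\<close> down leaves one of finitely many lattice vectors as
  remainder, whose integer coefficients are bounded independently of \<open>N\<close>.\<close>

lemma eventually_multiple_int_comb:
  fixes gs :: "(int^'n) list"
  assumes X: "finite X" and k: "a = int_comb gs X k"
    and c: "rvec a = (\<Sum>j\<in>X. c j *\<^sub>R rvec (gs ! j))" and pos: "\<And>j. j \<in> X - S \<Longrightarrow> c j > 0"
  shows "eventually (\<lambda>N. \<exists>n. int N *s a = int_comb gs X n \<and> (\<forall>j\<in>X - S. n j \<ge> 1)) sequentially"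
proof -
  define e where "e N = int_comb gs X (\<lambda>j. int N * k j - \<lfloor>real N * c j\<rfloor>)" for N
  define B where "B = (\<Sum>j\<in>X. norm (rvec (gs ! j)))"
  have e_eq: "int N *s a = e N + int_comb gs X (\<lambda>j. \<lfloor>real N * c j\<rfloor>)" for N
    by (simp add: e_def int_comb_diff int_comb_scale k)
  have "\<forall>i. \<bar>e N $ i\<bar> \<le> \<lfloor>B\<rfloor>" for N
  proof
    fix i
    have "rvec (e N) = rvec (int N *s a) - rvec (int_comb gs X (\<lambda>j. \<lfloor>real N * c j\<rfloor>))"
      unfolding e_eq rvec_add by simp
    also have "\<dots> = (\<Sum>j\<in>X. frac (real N * c j) *\<^sub>R rvec (gs ! j))"
      by (simp add: rvec_scale c rvec_int_comb scaleR_sum_right frac_def scaleR_left_diff_distrib sum_subtractf)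
    also have "norm \<dots> \<le> B" unfolding B_def
    proof (rule sum_norm_le)
      fix j
      have "\<bar>frac (real N * c j)\<bar> \<le> 1" using frac_lt_1[of "real N * c j"] by (simp add: frac_ge_0)
      then show "norm (frac (real N * c j) *\<^sub>R rvec (gs ! j)) \<le> norm (rvec (gs ! j))"
        by (simp add: mult_left_le_one_le)
    qed
    finally have "\<bar>rvec (e N) $ i\<bar> \<le> B" using component_le_norm_cart[of "rvec (e N)" i] by linarith
    then show "\<bar>e N $ i\<bar> \<le> \<lfloor>B\<rfloor>" by (simp add: rvec_def le_floor_iff)
  qed
  then have "range e \<subseteq> {v. \<forall>i. \<bar>v $ i\<bar> \<le> \<lfloor>B\<rfloor>}" by blast
  then have fin: "finite (range e)" using finite_bounded_int_vec finite_subset by blast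
  have "\<forall>v\<in>range e. \<exists>l. v = int_comb gs X l" unfolding e_def by blast
  then obtain \<rho> where \<rho>: "\<And>v. v \<in> range e \<Longrightarrow> v = int_comb gs X (\<rho> v)" by metis
  define D where "D = (\<Sum>v\<in>range e. \<Sum>j\<in>X. \<bar>\<rho> v j\<bar>)"
  have D: "- D \<le> \<rho> (e N) j" if "j \<in> X" for N j
  proof -
    have "\<bar>\<rho> (e N) j\<bar> \<le> (\<Sum>j\<in>X. \<bar>\<rho> (e N) j\<bar>)"
      using X that by (intro member_le_sum) auto
    also have "\<dots> \<le> D" unfolding D_def
      using fin by (intro member_le_sum[where f="\<lambda>v. \<Sum>j\<in>X. \<bar>\<rho> v j\<bar>"]) (auto intro: sum_nonneg)
    finally show ?thesis by linarith
  qed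
  \<comment> \<open>The threshold \<open>D + 1\<close> instead of \<open>D\<close> yields
    coefficients at least 1, not merely nonnegative; \<open>exact_at_below_dim\<close> relies on
    this.\<close>
  have "eventually (\<lambda>N. real N * c j \<ge> real_of_int (D + 1)) sequentially" if "j \<in> X - S" for j
  proof -
    have "filterlim (\<lambda>N. c j * real N) at_top sequentially"
      by (rule filterlim_tendsto_pos_mult_at_top[OF tendsto_const pos[OF that] filterlim_real_sequentially])
    then show ?thesis by (simp add: filterlim_at_top mult.commute)
  qed
  then have "eventually (\<lambda>N. \<forall>j\<in>X - S. real N * c j \<ge> real_of_int (D + 1)) sequentially"
    using X by (intro eventually_ball_finite) auto
  then show ?thesis
  proof (rule eventually_mono)
    fix N assume N: "\<forall>j\<in>X - S. real N * c j \<ge> real_of_int (D + 1)"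
    have "int N *s a = int_comb gs X (\<lambda>j. \<rho> (e N) j + \<lfloor>real N * c j\<rfloor>)"
      unfolding e_eq int_comb_add using \<rho>[of "e N"] by simp
    moreover have "\<rho> (e N) j + \<lfloor>real N * c j\<rfloor> \<ge> 1" if "j \<in> X - S" for j
    proof -
      have "D + 1 \<le> \<lfloor>real N * c j\<rfloor>" using N that by (simp add: le_floor_iff)
      then show ?thesis using D[of j N] that by simp
    qed
    ultimately show "\<exists>n. int N *s a = int_comb gs X n \<and> (\<forall>j\<in>X - S. n j \<ge> 1)" by blast
  qed
qed

lemma order_convex_Mloc:
  assumes gs: "distinct gs"
  shows "order_convex {S. S \<subseteq> {..<length gs} \<and> a \<in> Mloc (monoid_gen (set gs)) gs S}"
  unfolding order_convex_def
proof (intro ballI allI impI)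
  fix R T S
  assume "R \<in> {S. S \<subseteq> {..<length gs} \<and> a \<in> Mloc (monoid_gen (set gs)) gs S}"
    and "T \<in> {S. S \<subseteq> {..<length gs} \<and> a \<in> Mloc (monoid_gen (set gs)) gs S}"
    and sub: "R \<subseteq> S" "S \<subseteq> T"
  then have RT: "R \<subseteq> {..<length gs}" "T \<subseteq> {..<length gs}" "a \<in> Mloc (monoid_gen (set gs)) gs R"
    by auto
  then have S: "S \<subseteq> {..<length gs}" using sub by blast
  have "a \<in> Mloc (monoid_gen (set gs)) gs S"
    using RT(3) sub unfolding Mloc_iff[OF gs RT(1)] Mloc_iff[OF gs S] by blast
  then show "S \<in> {S. S \<subseteq> {..<length gs} \<and> a \<in> Mloc (monoid_gen (set gs)) gs S}"
    using S by simp
qed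

text \<open>Seminormality survives localisation: a large shift of \<open>z\<close> in the inverted
  directions puts both multiples into \<open>M\<close>, and the shift is undone afterwards.\<close>

lemma seminormal_Mloc:
  fixes gs :: "(int^'n) list"
  defines "M \<equiv> monoid_gen (set gs)"
  assumes gs: "distinct gs" and S: "S \<subseteq> {..<length gs}" and sn: "seminormal M"
    and z: "z \<in> gp M" and z2: "2 *s z \<in> Mloc M gs S" and z3: "3 *s z \<in> Mloc M gs S"
  shows "z \<in> Mloc M gs S"
proof -
  let ?I = "{..<length gs}"
  note Mloc = Mloc_iff[OF gs S, folded M_def] and gp = gp_iff[OF gs, folded M_def]
    and M = monoid_gen_iff[OF gs, folded M_def]
  have "finite S" using S finite_subset by blast
  obtain k where k: "z = int_comb gs ?I k" using z unfolding gp by blast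
  obtain k2 where k2: "\<forall>j\<in>?I - S. k2 j \<ge> 0" "2 *s z = int_comb gs ?I k2" using z2 unfolding Mloc by blast
  obtain k3 where k3: "\<forall>j\<in>?I - S. k3 j \<ge> 0" "3 *s z = int_comb gs ?I k3" using z3 unfolding Mloc by blast
  \<comment> \<open>Large enough that both \<open>k2 j + 2 * u j\<close> and
    \<open>k3 j + 3 * u j\<close> are nonnegative on \<open>S\<close>.\<close>
  define u where "u j = (if j \<in> S then \<bar>k2 j\<bar> + \<bar>k3 j\<bar> else 0)" for j
  define w where "w = z + int_comb gs ?I u"
  have "2 *s w = int_comb gs ?I (\<lambda>j. k2 j + 2 * u j)"
    unfolding w_def by (simp only: vector_add_ldistrib int_comb_add int_comb_scale k2(2))
  moreover have "k2 j + 2 * u j \<ge> 0" if "j < length gs" for j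
    using k2(1) that by (cases "j \<in> S") (auto simp: u_def)
  ultimately have "2 *s w \<in> M" unfolding M by (intro exI[of _ "\<lambda>j. k2 j + 2 * u j"]) simp
  moreover have "3 *s w = int_comb gs ?I (\<lambda>j. k3 j + 3 * u j)"
    unfolding w_def by (simp only: vector_add_ldistrib int_comb_add int_comb_scale k3(2))
  moreover have "k3 j + 3 * u j \<ge> 0" if "j < length gs" for j
    using k3(1) that by (cases "j \<in> S") (auto simp: u_def)
  ultimately have "3 *s w \<in> M" unfolding M by (intro exI[of _ "\<lambda>j. k3 j + 3 * u j"]) simp
  have "w = int_comb gs ?I (\<lambda>j. k j + u j)" unfolding w_def k int_comb_add ..
  then have "w \<in> gp M" unfolding gp by blast
  then have "w \<in> M" using sn \<open>2 *s w \<in> M\<close> \<open>3 *s w \<in> M\<close> unfolding seminormal_def by blast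
  then obtain n where n: "\<forall>j<length gs. n j \<ge> 0" "w = int_comb gs ?I n" unfolding M by blast
  have "z = int_comb gs ?I (\<lambda>j. n j - u j)" unfolding int_comb_diff n(2)[symmetric] w_def by simp
  then show ?thesis unfolding Mloc using n(1) by (intro exI[of _ "\<lambda>j. n j - u j"]) (simp add: u_def)
qed

text \<open>If all multiples of \<open>a\<close> from the \<open>(n + 1)\<close>-st on lie in the localisation, then so do twice and
  three times \<open>n a\<close>, hence \<open>n a\<close> by seminormality.\<close>

lemma Mloc_if_eventually_multiple:
  fixes gs :: "(int^'n) list"
  defines "M \<equiv> monoid_gen (set gs)"
  assumes gs: "distinct gs" and S: "S \<subseteq> {..<length gs}" and sn: "seminormal M"
    and a: "a \<in> gp M" and ev: "eventually (\<lambda>N. int N *s a \<in> Mloc M gs S) sequentially"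
  shows "a \<in> Mloc M gs S"
proof -
  obtain k where k: "a = int_comb gs {..<length gs} k"
    using a gp_iff[OF gs] unfolding M_def by blast
  have gp: "int N *s a \<in> gp M" for N
    unfolding M_def gp_iff[OF gs] k int_comb_scale[symmetric] by blast
  obtain N0 where N0: "\<And>N. N \<ge> N0 \<Longrightarrow> int N *s a \<in> Mloc M gs S"
    using ev unfolding eventually_sequentially by blast
  have "n \<ge> 1 \<Longrightarrow> (\<And>N. N \<ge> n \<Longrightarrow> int N *s a \<in> Mloc M gs S) \<Longrightarrow> a \<in> Mloc M gs S" for n
  proof (induction n rule: dec_induct)
    case base
    then show ?case using base[of 1] by simp
  next
    case (step n)
    have "2 *s (int n *s a) \<in> Mloc M gs S" "3 *s (int n *s a) \<in> Mloc M gs S"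
      using step.prems[of "2 * n"] step.prems[of "3 * n"] step.hyps by simp_all
    then have "int n *s a \<in> Mloc M gs S"
      using seminormal_Mloc[OF gs S, folded M_def, OF sn gp] by blast
    then have "int N *s a \<in> Mloc M gs S" if "N \<ge> n" for N
      using step.prems[of N] that by (cases "N = n") auto
    then show ?case by (rule step.IH)
  qed
  \<comment> \<open>The descent stays at \<open>n \<ge> 1\<close>, where \<open>2 * n\<close> and
    \<open>3 * n\<close> both exceed \<open>n\<close>.\<close>
  from this[of "max 1 N0"] show ?thesis using N0 by simp
qed

section \<open>Exactness of the Cech complex in a fixed degree\<close>

lemma exact_at_outside_cone:
  fixes gs :: "(int^'n) list" and K :: "'k::field itself"
  defines "M \<equiv> monoid_gen (set gs)"
  assumes gs: "distinct gs" and sn: "seminormal M" and a: "a \<in> gp M" and out: "rvec a \<notin> uminus ` cn M"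
  shows "exact_at K i {S. S \<subseteq> {..<length gs} \<and> a \<in> Mloc M gs S}"
proof -
  let ?I = "{..<length gs}" and ?g = "\<lambda>j. rvec (gs ! j)"
  define P where "P = {S. S \<subseteq> ?I \<and> a \<in> Mloc M gs S}"
  define \<phi> where "\<phi> = reach ?g ?I (rvec a)"
  note Mloc = Mloc_iff[OF gs, folded M_def]
  have feas: "feasible ?g ?I (rvec a) S (\<lambda>j. real_of_int (k j))"
    if "\<forall>j\<in>?I - S. k j \<ge> 0" "a = int_comb gs ?I k" for S k
    using that by (simp add: feasible_def rvec_int_comb)
  have "exact_at K i P"
  proof (rule exact_at_fibres[where \<phi> = \<phi>])
    show "finite P" unfolding P_def by (rule finite_subset[of _ "Pow ?I"]) auto
    show "order_convex P" unfolding P_def M_def by (rule order_convex_Mloc[OF gs])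
    show "finite S" if "S \<in> P" for S using that finite_subset unfolding P_def by blast
    show "\<phi> S \<subseteq> \<phi> T" if "S \<subseteq> T" for S T unfolding \<phi>_def by (rule reach_mono[OF that])
    fix S assume "S \<in> P"
    then have SI: "S \<subseteq> ?I" and aS: "a \<in> Mloc M gs S" by (auto simp: P_def)
    obtain k where k: "\<forall>j\<in>?I - S. k j \<ge> 0" "a = int_comb gs ?I k"
      using aS unfolding Mloc[OF SI] by blast
    define X where "X = \<phi> S"
    have XI: "X \<subseteq> ?I" unfolding X_def \<phi>_def by (rule reach_subset[OF SI])
    have "finite X" using XI finite_subset by blast
    \<comment> \<open>Integer coefficients of \<open>a\<close> are feasible real ones, hence vanish
      off \<open>X\<close>. So \<open>a\<close> lies in the group generated by the generators in
      \<open>X\<close>, as the rounding argument requires.\<close>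
    have "k j = 0" if "j \<in> ?I - X" for j
      using feasible_zero_outside_reach[OF feas[OF k]] that unfolding X_def \<phi>_def by simp
    then have aX: "a = int_comb gs X k"
      unfolding k(2) by (intro int_comb_shrink[OF _ XI]) auto
    have fibre: "{T \<in> P. \<phi> T = X} = conerve X {c. (\<Sum>j\<in>X. c j *\<^sub>R ?g j) = rvec a} X"
    proof -
      have "{T \<in> P. \<phi> T = X} = {T. T \<subseteq> ?I \<and> \<phi> T = X \<and> (\<exists>c. feasible ?g ?I (rvec a) T c)}"
      proof (intro set_eqI iffI)
        fix T assume "T \<in> {T \<in> P. \<phi> T = X}"
        then have T: "T \<subseteq> ?I" "a \<in> Mloc M gs T" "\<phi> T = X" by (auto simp: P_def)
        then show "T \<in> {T. T \<subseteq> ?I \<and> \<phi> T = X \<and> (\<exists>c. feasible ?g ?I (rvec a) T c)}"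
          using feas[of T] unfolding Mloc[OF T(1)] by blast
      next
        fix T assume "T \<in> {T. T \<subseteq> ?I \<and> \<phi> T = X \<and> (\<exists>c. feasible ?g ?I (rvec a) T c)}"
        then obtain d where T: "T \<subseteq> ?I" "\<phi> T = X" and d: "feasible ?g ?I (rvec a) T d" by blast
        \<comment> \<open>Real feasibility is upgraded to membership in \<open>Mloc M gs T\<close>:
          strictly positive coefficients on \<open>X - T\<close> become positive integers for all
          large multiples of \<open>a\<close>, and seminormality descends to \<open>a\<close>
          itself.\<close>
        obtain c where c: "feasible ?g ?I (rvec a) T c" "\<And>j. j \<in> X - T \<Longrightarrow> c j > 0"
          using feasible_positive_on_reach[OF finite_lessThan T(1) d] T(2) unfolding \<phi>_def by metis
        have "(\<Sum>j\<in>X. c j *\<^sub>R ?g j) = (\<Sum>j\<in>?I. c j *\<^sub>R ?g j)"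
          by (rule sum.mono_neutral_left[OF finite_lessThan XI])
             (use feasible_zero_outside_reach[OF c(1)] T(2) in \<open>auto simp: \<phi>_def\<close>)
        then have ac: "rvec a = (\<Sum>j\<in>X. c j *\<^sub>R ?g j)" using c(1) by (simp add: feasible_def)
        have "a \<in> Mloc M gs T" unfolding M_def
        proof (rule Mloc_if_eventually_multiple[OF gs T(1)])
          show "seminormal (monoid_gen (set gs))" "a \<in> gp (monoid_gen (set gs))"
            using sn a by (simp_all add: M_def)
          show "eventually (\<lambda>N. int N *s a \<in> Mloc (monoid_gen (set gs)) gs T) sequentially"
            using eventually_multiple_int_comb[OF \<open>finite X\<close> aX ac c(2)]
          proof (rule eventually_mono)
            fix N assume "\<exists>n. int N *s a = int_comb gs X n \<and> (\<forall>j\<in>X - T. n j \<ge> 1)"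
            then obtain n where n: "int N *s a = int_comb gs X n" "\<forall>j\<in>X - T. n j \<ge> 1" by blast
            have "int N *s a = int_comb gs ?I (\<lambda>j. if j \<in> X then n j else 0)"
              using n(1) XI by (simp add: int_comb_extend)
            moreover have "(if j \<in> X then n j else 0) \<ge> 0" if "j \<in> ?I - T" for j
              using n(2) that by force
            ultimately show "int N *s a \<in> Mloc (monoid_gen (set gs)) gs T"
              unfolding Mloc_iff[OF gs T(1)]
              by (intro exI[of _ "\<lambda>j. if j \<in> X then n j else 0"] conjI ballI)
          qed
        qed
        then show "T \<in> {T \<in> P. \<phi> T = X}" using T by (simp add: P_def)
      qed
      also have "\<dots> = conerve X {c. (\<Sum>j\<in>X. c j *\<^sub>R ?g j) = rvec a} X"
        unfolding \<phi>_def
        by (rule conerve_eq_reach_fibre[OF finite_lessThan SI feas[OF k], symmetric])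
           (simp add: X_def \<phi>_def)
      finally show ?thesis .
    qed
    have "exact_at K i (conerve X {c. (\<Sum>j\<in>X. c j *\<^sub>R ?g j) = rvec a} X)"
    proof (rule exact_at_conerve[where g = ?g, OF \<open>finite X\<close> subset_refl fun_convex_affine], rule disjI1, rule ballI, rule ccontr)
      \<comment> \<open>A function lying in none of the half-spaces would have only nonpositive
        values and so write \<open>- rvec a\<close> as a point of the cone.\<close>
      fix c assume "c \<in> {c. (\<Sum>j\<in>X. c j *\<^sub>R ?g j) = rvec a}" and neg: "\<not> (\<exists>v\<in>X. c v > 0)"
      then have sum: "(\<Sum>j\<in>X. c j *\<^sub>R ?g j) = rvec a" by simp
      define d where "d j = (if j \<in> X then - c j else 0)" for j
      have "(\<Sum>j\<in>?I. d j *\<^sub>R ?g j) = (\<Sum>j\<in>X. (- c j) *\<^sub>R ?g j)"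
        unfolding d_def by (rule sum_extend_by_zero[OF finite_lessThan XI])
      also have "\<dots> = - rvec a" using sum by (simp add: sum_negf)
      finally have "- rvec a = (\<Sum>j<length gs. d j *\<^sub>R ?g j)" by simp
      moreover have "d j \<ge> 0" for j using neg by (auto simp: d_def not_less)
      ultimately have "- rvec a \<in> cn M"
        unfolding M_def cn_monoid_gen[OF gs] by (intro exI[of _ d]) simp
      then show False using out by (metis image_eqI minus_minus)
    qed
    then show "exact_at K i {T \<in> P. \<phi> T = \<phi> S}" using fibre X_def by simp
  qed
  then show ?thesis by (simp add: P_def)
qed

text \<open>With \<open>b = 0\<close>, \<open>reach\<close> sends \<open>S\<close> to the generators
  of the smallest face containing those of \<open>S\<close>. On a fibre, membership of
  \<open>a\<close> in the localisation is constant because positive integer relations can be added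
  to any representation of \<open>a\<close>.\<close>

lemma exact_at_below_dim:
  fixes gs :: "(int^'n) list" and K :: "'k::field itself"
  defines "M \<equiv> monoid_gen (set gs)"
  assumes gs: "distinct gs"
    and dim: "\<And>S. S \<subseteq> {..<length gs} \<Longrightarrow> a \<in> Mloc M gs S \<Longrightarrow>
      i < dim ((\<lambda>j. rvec (gs ! j)) ` reach (\<lambda>j. rvec (gs ! j)) {..<length gs} 0 S)"
  shows "exact_at K i {S. S \<subseteq> {..<length gs} \<and> a \<in> Mloc M gs S}"
proof -
  let ?I = "{..<length gs}" and ?g = "\<lambda>j. rvec (gs ! j)"
  define P where "P = {S. S \<subseteq> ?I \<and> a \<in> Mloc M gs S}"
  define \<phi> where "\<phi> = reach ?g ?I 0"
  note Mloc = Mloc_iff[OF gs, folded M_def]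
  have feas: "feasible ?g ?I 0 S (\<lambda>_. 0)" for S by (simp add: feasible_def)
  have "exact_at K i P"
  proof (rule exact_at_fibres[where \<phi> = \<phi>])
    show "finite P" unfolding P_def by (rule finite_subset[of _ "Pow ?I"]) auto
    show "order_convex P" unfolding P_def M_def by (rule order_convex_Mloc[OF gs])
    show "finite S" if "S \<in> P" for S using that finite_subset unfolding P_def by blast
    show "\<phi> S \<subseteq> \<phi> T" if "S \<subseteq> T" for S T unfolding \<phi>_def by (rule reach_mono[OF that])
    fix S assume "S \<in> P"
    then have SI: "S \<subseteq> ?I" and aS: "a \<in> Mloc M gs S" by (auto simp: P_def)
    obtain k where k: "\<forall>j\<in>?I - S. k j \<ge> 0" "a = int_comb gs ?I k"
      using aS unfolding Mloc[OF SI] by blast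
    define X where "X = \<phi> S"
    have XI: "X \<subseteq> ?I" unfolding X_def \<phi>_def by (rule reach_subset[OF SI])
    have SX: "S \<subseteq> X" unfolding X_def \<phi>_def by (rule reach_superset)
    have "finite X" using XI finite_subset by blast
    have fibre: "{T \<in> P. \<phi> T = X} = conerve X {c. (\<Sum>j\<in>X. c j *\<^sub>R ?g j) = 0} X"
    proof -
      have "{T \<in> P. \<phi> T = X} = {T. T \<subseteq> ?I \<and> \<phi> T = X \<and> (\<exists>c. feasible ?g ?I 0 T c)}"
      proof (intro set_eqI iffI)
        fix T assume "T \<in> {T \<in> P. \<phi> T = X}"
        then show "T \<in> {T. T \<subseteq> ?I \<and> \<phi> T = X \<and> (\<exists>c. feasible ?g ?I 0 T c)}"
          using feas[of T] by (auto simp: P_def)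
      next
        fix T assume "T \<in> {T. T \<subseteq> ?I \<and> \<phi> T = X \<and> (\<exists>c. feasible ?g ?I 0 T c)}"
        then have T: "T \<subseteq> ?I" "\<phi> T = X" by auto
        obtain c where c: "feasible ?g ?I 0 T c" "\<And>j. j \<in> X - T \<Longrightarrow> c j > 0"
          using feasible_positive_on_reach[OF finite_lessThan T(1) feas] T(2) unfolding \<phi>_def by metis
        have "(\<Sum>j\<in>X. c j *\<^sub>R ?g j) = (\<Sum>j\<in>?I. c j *\<^sub>R ?g j)"
          by (rule sum.mono_neutral_left[OF finite_lessThan XI])
             (use feasible_zero_outside_reach[OF c(1)] T(2) in \<open>auto simp: \<phi>_def\<close>)
        then have 0: "rvec 0 = (\<Sum>j\<in>X. c j *\<^sub>R ?g j)" using c(1) by (simp add: feasible_def rvec_0)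
        \<comment> \<open>Rounding a real relation that is positive on \<open>X - T\<close>, viewed
          as a representation of the vector 0, gives an integer relation that is at least 1
          there.\<close>
        have "0 = int_comb gs X (\<lambda>_. 0)" by (simp add: int_comb_def)
        then have "eventually (\<lambda>N. \<exists>n. int N *s 0 = int_comb gs X n \<and> (\<forall>j\<in>X - T. n j \<ge> 1)) sequentially"
          by (rule eventually_multiple_int_comb[OF \<open>finite X\<close> _ 0 c(2)])
        then obtain N where "\<exists>n. int N *s 0 = int_comb gs X n \<and> (\<forall>j\<in>X - T. n j \<ge> 1)"
          using eventually_happens'[OF sequentially_bot] by blast
        then obtain n where n: "int_comb gs X n = 0" "\<And>j. j \<in> X - T \<Longrightarrow> n j \<ge> 1"
          by auto
        define D where "D = (\<Sum>j\<in>X. \<bar>k j\<bar>)"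
        have D: "\<bar>k j\<bar> \<le> D" if "j \<in> X" for j
          unfolding D_def using \<open>finite X\<close> that by (intro member_le_sum) auto
        \<comment> \<open>Adding \<open>D\<close> copies of the relation \<open>n\<close> preserves
          the value \<open>a\<close> and lifts every coefficient on \<open>X - T\<close> to a
          nonnegative one. Off \<open>X\<close> nothing changes, and \<open>k\<close> is already
          nonnegative there since \<open>S \<subseteq> X\<close>.\<close>
        define l where "l j = k j + D * (if j \<in> X then n j else 0)" for j
        have "int_comb gs ?I l = a"
          unfolding l_def int_comb_add int_comb_scale int_comb_extend[OF finite_lessThan XI] n(1)
          by (simp add: k(2))
        moreover have "l j \<ge> 0" if "j \<in> ?I - T" for j
        proof (cases "j \<in> X")
          case True
          then have "D * 1 \<le> D * n j" using n(2)[of j] that D[OF True] by (intro mult_left_mono) auto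
          then show ?thesis using D[OF True] True by (simp add: l_def)
        next
          case False
          then show ?thesis using k(1) SX that by (auto simp: l_def)
        qed
        ultimately have "a \<in> Mloc M gs T" unfolding Mloc[OF T(1)] by blast
        then show "T \<in> {T \<in> P. \<phi> T = X}" using T by (simp add: P_def)
      qed
      also have "\<dots> = conerve X {c. (\<Sum>j\<in>X. c j *\<^sub>R ?g j) = 0} X"
        unfolding \<phi>_def
        by (rule conerve_eq_reach_fibre[OF finite_lessThan SI feas, symmetric])
           (simp add: X_def \<phi>_def)
      finally show ?thesis .
    qed
    have "i < dim (?g ` X)" using dim[OF SI aS] by (simp add: X_def \<phi>_def)
    \<comment> \<open>No coordinate is constrained to vanish at the start, so \<open>Z = {}\<close>
      and the bound is just the dimension of the face.\<close>
    then have "exact_at K i (conerve X {c. (\<Sum>j\<in>X. c j *\<^sub>R ?g j) = 0} X)"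
      by (intro exact_at_conerve[where g = ?g, OF \<open>finite X\<close> subset_refl fun_convex_affine] disjI2
          exI[of _ "{}"]) simp
    then show "exact_at K i {T \<in> P. \<phi> T = \<phi> S}" using fibre X_def by simp
  qed
  then show ?thesis by (simp add: P_def)
qed

text \<open>The condition \<open>Suc (card S) = i\<close> in \<open>exact_at\<close> leaves only the
  zero primitive in degree 0, which matches the separate case of
  \<open>loc_coh_nonzero\<close>.\<close>

lemma not_loc_coh_nonzero_if_exact_at:
  fixes K :: "'k::field itself"
  assumes "exact_at K i {S. S \<subseteq> {..<length gs} \<and> a \<in> Mloc M gs S}"
  shows "\<not> loc_coh_nonzero K M gs i a"
proof
  let ?P = "{S. S \<subseteq> {..<length gs} \<and> a \<in> Mloc M gs S}"
  assume "loc_coh_nonzero K M gs i a"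
  then obtain f :: "nat set \<Rightarrow> 'k" where f: "cech_cochain K M gs i a f"
    and cyc: "\<forall>T. T \<subseteq> {..<length gs} \<and> card T = Suc i \<and> a \<in> Mloc M gs T \<longrightarrow> cech_diff f T = 0"
    and nz: "if i = 0 then f \<noteq> (\<lambda>_. 0)
           else \<not> (\<exists>g. cech_cochain K M gs (i - 1) a g \<and>
                    (\<forall>S. S \<subseteq> {..<length gs} \<and> card S = i \<and> a \<in> Mloc M gs S \<longrightarrow> f S = cech_diff g S))"
    unfolding loc_coh_nonzero_def by blast
  have "\<exists>g. (\<forall>S. g S \<noteq> 0 \<longrightarrow> S \<in> ?P \<and> Suc (card S) = i) \<and>
        (\<forall>S\<in>?P. card S = i \<longrightarrow> cech_diff g S = f S)"
    by (rule exact_atD[OF assms]) (use f cyc in \<open>auto simp: cech_cochain_def\<close>)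
  then obtain g where g: "\<And>S. g S \<noteq> 0 \<Longrightarrow> S \<in> ?P \<and> Suc (card S) = i"
    and dg: "\<And>S. S \<in> ?P \<Longrightarrow> card S = i \<Longrightarrow> cech_diff g S = f S" by blast
  show False
  proof (cases "i = 0")
    case True
    then have "f \<noteq> (\<lambda>_. 0)" using nz by simp
    then obtain S where S: "f S \<noteq> 0" by (auto simp: fun_eq_iff)
    then have SP: "S \<in> ?P" "card S = i" using f unfolding cech_cochain_def by blast+
    have "cech_diff g S = 0"
      by (rule cech_diff_eq_0) (use g True in blast)
    then show False using dg[OF SP] S by simp
  next
    case False
    have "cech_cochain K M gs (i - 1) a g"
      unfolding cech_cochain_def
    proof (intro allI impI)
      fix S assume "g S \<noteq> 0"
      from g[OF this] show "S \<subseteq> {..<length gs} \<and> card S = i - 1 \<and> a \<in> Mloc M gs S" by auto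
    qed
    moreover have "f S = cech_diff g S" if "S \<subseteq> {..<length gs} \<and> card S = i \<and> a \<in> Mloc M gs S" for S
      using dg[of S] that by simp
    ultimately show False using nz False by auto
  qed
qed

section \<open>The face attached to a localisation, and the conclusion\<close>

text \<open>\<open>F\<close> is the cone over the generators in \<open>X\<close>. Everything rests
  on relations that are nonnegative off \<open>X\<close>, which must vanish there by
  \<open>relation_zero_outside_reach\<close>.\<close>

lemma face_of_reach:
  fixes gs :: "(int^'n) list"
  defines "M \<equiv> monoid_gen (set gs)"
    and "g \<equiv> (\<lambda>j. rvec (gs ! j))" and "I \<equiv> {..<length gs}"
  assumes gs: "distinct gs" and S: "S \<subseteq> I" and X: "X = reach g I 0 S"
    and aS: "a \<in> Mloc M gs S" and neg: "rvec a \<in> uminus ` cn M"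
  defines "F \<equiv> {\<Sum>j\<in>X. c j *\<^sub>R g j | c. \<forall>j\<in>X. c j \<ge> 0}"
  shows "F face_of cn M" "dim F \<le> dim (g ` X)" "a \<in> uminus ` Mbar M F"
proof -
  have "finite I" by (simp add: I_def)
  have XI: "X \<subseteq> I" unfolding X by (rule reach_subset[OF S])
  have SX: "S \<subseteq> X" unfolding X by (rule reach_superset)
  have cn: "x \<in> cn M \<longleftrightarrow> (\<exists>c. (\<forall>j\<in>I. c j \<ge> 0) \<and> x = (\<Sum>j\<in>I. c j *\<^sub>R g j))" for x
    using cn_monoid_gen[OF gs, of x] by (simp add: M_def g_def I_def Ball_def)
  have rel0: "e v = 0" if "(\<Sum>j\<in>I. e j *\<^sub>R g j) = 0" "\<And>j. j \<in> I - X \<Longrightarrow> e j \<ge> 0" "v \<in> I - X"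
    for e :: "nat \<Rightarrow> real" and v
    using that relation_zero_outside_reach[OF \<open>finite I\<close> S, of g 0 "\<lambda>_. 0" e v]
    unfolding X by (simp add: feasible_def)
  have FI: "x \<in> F" if "x = (\<Sum>j\<in>I. c j *\<^sub>R g j)" "\<forall>j\<in>I. c j \<ge> 0" "\<And>j. j \<in> I - X \<Longrightarrow> c j = 0" for x c
  proof -
    have "x = (\<Sum>j\<in>X. c j *\<^sub>R g j)"
      unfolding that(1) by (rule sum.mono_neutral_right[OF \<open>finite I\<close> XI]) (use that(3) in auto)
    then show ?thesis using that(2) XI unfolding F_def by blast
  qed
  show "F face_of cn M" unfolding face_of_def
  proof (intro conjI ballI impI)
    show "F \<subseteq> cn M"
    proof
      fix x assume "x \<in> F"
      then obtain c where c: "x = (\<Sum>j\<in>X. c j *\<^sub>R g j)" "\<forall>j\<in>X. c j \<ge> 0" unfolding F_def by blast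
      have "x = (\<Sum>j\<in>I. (if j \<in> X then c j else 0) *\<^sub>R g j)"
        unfolding c(1) by (rule sum_extend_by_zero[OF \<open>finite I\<close> XI, symmetric])
      then show "x \<in> cn M" unfolding cn
        using c(2) by (intro exI[of _ "\<lambda>j. if j \<in> X then c j else 0"]) simp
    qed
    show "convex F" unfolding convex_def
    proof (intro ballI allI impI)
      fix x y u v assume "x \<in> F" "y \<in> F" and uv: "0 \<le> u" "0 \<le> v" "u + v = (1::real)"
      then obtain c d where "x = (\<Sum>j\<in>X. c j *\<^sub>R g j)" "\<forall>j\<in>X. c j \<ge> 0"
        "y = (\<Sum>j\<in>X. d j *\<^sub>R g j)" "\<forall>j\<in>X. d j \<ge> 0" unfolding F_def by blast
      then have "u *\<^sub>R x + v *\<^sub>R y = (\<Sum>j\<in>X. (u * c j + v * d j) *\<^sub>R g j) \<and> (\<forall>j\<in>X. u * c j + v * d j \<ge> 0)"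
        using uv by (simp add: scaleR_left_distrib sum.distrib scaleR_sum_right)
      then show "u *\<^sub>R x + v *\<^sub>R y \<in> F" unfolding F_def by (intro CollectI exI[of _ "\<lambda>j. u * c j + v * d j"])
    qed
    fix p q x assume "p \<in> cn M" "q \<in> cn M" "x \<in> F" "x \<in> open_segment p q"
    obtain \<alpha> where \<alpha>: "\<forall>j\<in>I. \<alpha> j \<ge> 0" "p = (\<Sum>j\<in>I. \<alpha> j *\<^sub>R g j)" using \<open>p \<in> cn M\<close> unfolding cn by blast
    obtain \<beta> where \<beta>: "\<forall>j\<in>I. \<beta> j \<ge> 0" "q = (\<Sum>j\<in>I. \<beta> j *\<^sub>R g j)" using \<open>q \<in> cn M\<close> unfolding cn by blast
    obtain \<gamma> where \<gamma>: "x = (\<Sum>j\<in>X. \<gamma> j *\<^sub>R g j)" using \<open>x \<in> F\<close> unfolding F_def by blast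
    obtain u where u: "0 < u" "u < 1" "x = (1 - u) *\<^sub>R p + u *\<^sub>R q"
      using \<open>x \<in> open_segment p q\<close> unfolding in_segment by blast
    define \<gamma>' where "\<gamma>' j = (if j \<in> X then \<gamma> j else 0)" for j
    have "x = (\<Sum>j\<in>I. \<gamma>' j *\<^sub>R g j)"
      unfolding \<gamma>'_def \<gamma> by (rule sum_extend_by_zero[OF \<open>finite I\<close> XI, symmetric])
    \<comment> \<open>Comparing two representations of \<open>x\<close> gives such a relation. Off
      \<open>X\<close> it is a positive combination of \<open>\<alpha>\<close> and
      \<open>\<beta>\<close>, so both vanish there and the endpoints lie in
      \<open>F\<close>.\<close>
    then have "(\<Sum>j\<in>I. ((1 - u) * \<alpha> j + u * \<beta> j - \<gamma>' j) *\<^sub>R g j) = ((1 - u) *\<^sub>R p + u *\<^sub>R q) - x"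
      unfolding \<alpha>(2) \<beta>(2)
      by (simp only: scaleR_left_diff_distrib scaleR_left_distrib sum_subtractf sum.distrib
          scaleR_sum_right scaleR_scaleR)
    then have sum0: "(\<Sum>j\<in>I. ((1 - u) * \<alpha> j + u * \<beta> j - \<gamma>' j) *\<^sub>R g j) = 0" using u(3) by simp
    have "\<alpha> j = 0 \<and> \<beta> j = 0" if "j \<in> I - X" for j
    proof -
      have "(1 - u) * \<alpha> j + u * \<beta> j - \<gamma>' j = 0"
        by (rule rel0[OF sum0 _ that]) (use u \<alpha>(1) \<beta>(1) in \<open>simp add: \<gamma>'_def\<close>)
      then have "(1 - u) * \<alpha> j + u * \<beta> j = 0" using that by (simp add: \<gamma>'_def)
      moreover have "(1 - u) * \<alpha> j \<ge> 0" "u * \<beta> j \<ge> 0" using u \<alpha>(1) \<beta>(1) that by simp_all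
      ultimately have "(1 - u) * \<alpha> j = 0" "u * \<beta> j = 0" by linarith+
      then show ?thesis using u by simp
    qed
    then show "p \<in> F" "q \<in> F" using FI[OF \<alpha>(2,1)] FI[OF \<beta>(2,1)] by blast+
  qed
  have "F \<subseteq> span (g ` X)"
  proof
    fix x assume "x \<in> F"
    then obtain c where "x = (\<Sum>j\<in>X. c j *\<^sub>R g j)" unfolding F_def by blast
    then show "x \<in> span (g ` X)" by (auto intro!: span_sum span_mul intro: span_base)
  qed
  then show "dim F \<le> dim (g ` X)" by (rule dim_mono)
  obtain k where k: "\<forall>j\<in>I - S. k j \<ge> 0" "a = int_comb gs I k"
    using aS S Mloc_iff[OF gs, of S a] unfolding M_def I_def by blast
  have "- rvec a \<in> cn M" using neg by auto
  then obtain c where c: "\<forall>j\<in>I. c j \<ge> 0" "- rvec a = (\<Sum>j\<in>I. c j *\<^sub>R g j)" unfolding cn by blast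
  \<comment> \<open>Adding the localised representation of \<open>a\<close> to the conic one of
    \<open>- rvec a\<close> gives a relation; hence both are supported on \<open>X\<close>. The
    first puts \<open>- a\<close> into the group of the face, the second puts
    \<open>rvec (- a)\<close> into \<open>F\<close>.\<close>
  have sum0: "(\<Sum>j\<in>I. (real_of_int (k j) + c j) *\<^sub>R g j) = 0"
  proof -
    have "(\<Sum>j\<in>I. real_of_int (k j) *\<^sub>R g j) = rvec a" by (simp add: k(2) rvec_int_comb g_def)
    then show ?thesis by (simp add: scaleR_left_distrib sum.distrib c(2)[symmetric])
  qed
  have off: "k j = 0 \<and> c j = 0" if "j \<in> I - X" for j
  proof -
    have *: "real_of_int (k j) \<ge> 0" "c j \<ge> 0" if "j \<in> I - X" for j
      using k(1) c(1) that SX by auto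
    then have "real_of_int (k j) + c j = 0"
      by (intro rel0[OF sum0 _ that]) (use * in \<open>simp add: add_nonneg_nonneg\<close>)
    then show ?thesis using *[OF that] by simp
  qed
  have "int_comb gs I (\<lambda>j. - k j) = int_comb gs X (\<lambda>j. - k j)"
    by (rule int_comb_shrink[OF \<open>finite I\<close> XI]) (use off in simp)
  then have "- a = int_comb gs X (\<lambda>j. - k j)"
    unfolding k(2) by (simp add: int_comb_def vec_eq_iff sum_negf)
  moreover have "int_comb gs X (\<lambda>j. - k j) \<in> gp {y \<in> monoid_gen (set gs). rvec y \<in> F}"
  proof (rule int_comb_in_gp[OF gs XI[unfolded I_def]])
    fix n :: "nat \<Rightarrow> int" assume "\<And>j. j \<in> X \<Longrightarrow> n j \<ge> 0"
    then show "rvec (int_comb gs X n) \<in> F"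
      unfolding F_def rvec_int_comb g_def by (intro CollectI exI[of _ "\<lambda>j. real_of_int (n j)"]) simp
  qed
  moreover have "rvec (- a) \<in> F"
    unfolding rvec_minus by (rule FI[OF c(2,1)]) (use off in blast)
  ultimately have "- a \<in> Mbar M F" unfolding Mbar_def M_def by simp
  then show "a \<in> uminus ` Mbar M F" by (metis image_eqI minus_minus)
qed

theorem theorem4p3:
  fixes M :: "(int^'n) set" and gs :: "(int^'n) list" and K :: "'k::field itself"
  assumes "affine_monoid M" and "positive_monoid M" and "seminormal M"
    and "distinct gs" and "0 \<notin> set gs" and "M = monoid_gen (set gs)"
  shows "(\<forall>i a. a \<in> gp M \<and> loc_coh_nonzero K M gs i a \<longrightarrow>
            (\<exists>F. F face_of cn M \<and> dim F \<le> i \<and> a \<in> uminus ` Mbar M F))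
       \<and> (\<forall>i a. a \<in> gp M \<and> rvec a \<notin> uminus ` cn M \<longrightarrow> \<not> loc_coh_nonzero K M gs i a)"
proof (intro conjI allI impI)
  have vanish: "\<not> loc_coh_nonzero K M gs i a" if "a \<in> gp M" "rvec a \<notin> uminus ` cn M" for i a
    using exact_at_outside_cone[of gs a K i] assms that
    by (intro not_loc_coh_nonzero_if_exact_at) simp
  fix i a
  show "\<not> loc_coh_nonzero K M gs i a" if "a \<in> gp M \<and> rvec a \<notin> uminus ` cn M"
    using vanish that by blast
  assume a: "a \<in> gp M \<and> loc_coh_nonzero K M gs i a"
  let ?g = "\<lambda>j. rvec (gs ! j)" and ?I = "{..<length gs}"
  have "\<not> exact_at K i {S. S \<subseteq> ?I \<and> a \<in> Mloc M gs S}"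
    using a not_loc_coh_nonzero_if_exact_at by blast
  \<comment> \<open>Contrapositive of \<open>exact_at_below_dim\<close>: failure of exactness in
    degree \<open>i\<close> needs a localisation containing \<open>a\<close> whose face has
    dimension at most \<open>i\<close>.\<close>
  then obtain S where S: "S \<subseteq> ?I" "a \<in> Mloc M gs S" "dim (?g ` reach ?g ?I 0 S) \<le> i"
    using exact_at_below_dim[OF assms(4), of a i K] assms(6) by (meson not_less)
  have "rvec a \<in> uminus ` cn M" using a vanish by blast
  then show "\<exists>F. F face_of cn M \<and> dim F \<le> i \<and> a \<in> uminus ` Mbar M F"
    using face_of_reach[OF assms(4) S(1) refl, of a] S(2,3) unfolding assms(6)
    by (meson order_trans)
qed

end
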